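(* Let $G$ be a weakly connected oriented graph on $n\ge 2$ vertices $1,\dots,n$ with $m\ge 1$ edges $e_1,\dots,e_m$, with non-zero edge weights in $\mathbb{C}\setminus\mathbb{R}^-$ and complex signless incidence matrix $N$. Suppose that $G$ contains cycles, that $wt(C)\in\mathbb{R}^-$ for all odd cycles $C$ of $G$ and that $wt(C)\in\mathbb{R}^+$ for all even cycles $C$ of $G$. Then $\operatorname{rank}(N)=n-1$ and the Moore--Penrose inverse $N^+$ of $N$ has entries $$(N^+)_{ij}=\frac{1}{\sum_{T\in\mathcal{T}(G)}|W_T|}\ \sum_{T\in\mathcal{T}(G),\ e_i\in T}|W_T|\,(N_T^+)_{ij},$$ where $\mathcal{T}(G)$ is the set of all oriented spanning trees $T$ of $G$ and, for $e_i=(u,v)\in T$, $$(N_T^+)_{ij}=\frac{(-1)^{d(e_i,j)}}{n}\begin{cases}\dfrac{|T_h(e_i)|}{\sqrt{w_{uv}}}\,\dfrac{|wt(\gamma_{j\to u})|}{wt(\gamma_{j\to u})} & \text{if } j\in T_t(e_i),\\[2mm] \dfrac{|T_t(e_i)|}{\sqrt{\overline{w_{uv}}}}\,\dfrac{|wt(\gamma_{j\to v})|}{wt(\gamma_{j\to v})} & \text{if } j\in T_h(e_i).\end{cases}$$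
   Context: An oriented graph $G$ is obtained from a finite simple undirected graph $G_u$ (its underlying graph) by giving each edge exactly one direction; it is weakly connected if $G_u$ is connected. Write $V(G)=\{1,\dots,n\}$ and $E(G)=\{e_1,\dots,e_m\}$. Each directed edge $(u,v)$ (tail $u$, head $v$) has a non-zero complex weight $w_{uv}$. $\mathbb{R}^+$ and $\mathbb{R}^-$ denote the positive and the negative real numbers, and $\sqrt{\cdot}$ is the principal square root. The complex signless incidence matrix of $G$ is the $n\times m$ matrix $N=(n_{ij})$ where, for $e_j=(u,v)$, $n_{ij}=\sqrt{w_{uv}}$ if $i=u$, $n_{ij}=\sqrt{\overline{w_{uv}}}$ if $i=v$, and $n_{ij}=0$ otherwise. Put $a_{ij}=w_{ij}$ if $(i,j)\in E(G)$, $a_{ij}=\overline{w_{ji}}$ if $(j,i)\in E(G)$, and $a_{ij}=0$ otherwise. The weight of a walk $\gamma=(i_1,\dots,i_k)$ in $G_u$ is $wt(\gamma)=\prod_{s=1}^{k-1}a_{i_si_{s+1}}$ (so a trivial one-vertex walk has weight $1$). A cycle of $G$ means a cycle of $G_u$; $wt(C)$ is the weight of the closed walk going once around $C$ in either direction (the two directions give complex conjugate values, so the conditions $wt(C)\in\mathbb{R}^\pm$ do not depend on the choice). For an oriented graph $H$, $W_H$ is the product of all edge weights of $H$. For a spanning tree $T$ and an edge $e_i=(u,v)$ of $T$: $T_t(e_i)$ and $T_h(e_i)$ are the connected components of $T-e_i$ containing the tail $u$ and the head $v$, respectively, and $|T_t(e_i)|,|T_h(e_i)|$ are their numbers of vertices;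 $d(e_i,j)=\min(d(u,j),d(v,j))$ with $d$ the distance in $T$; $\gamma_{j\to u}$ is the unique walk without repeated vertices from $j$ to $u$ in $T$. Here $N_T$ is the complex signless incidence matrix of $T$, and the rows of $N_T^+$ are labelled by the edges of $T$ (keeping the labels from $G$) and its columns by the vertices. *)

theory Defs
  imports
    Complex_Main
    "Graph_Theory.Graph_Theory"
    "Jordan_Normal_Form.Schur_Decomposition"
    "Jordan_Normal_Form.DL_Rank"
begin

section \<open>Moore--Penrose inverse\<close>

definition is_moore_penrose :: "complex mat \<Rightarrow> complex mat \<Rightarrow> bool" where
  "is_moore_penrose A X \<longleftrightarrow>
     X \<in> carrier_mat (dim_col A) (dim_row A) \<and>
     A * X * A = A \<and>
     X * A * X = X \<and>
     mat_adjoint (A * X) = A * X \<and>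
     mat_adjoint (X * A) = X * A"

definition moore_penrose_inverse :: "complex mat \<Rightarrow> complex mat" where
  "moore_penrose_inverse A = (THE X. is_moore_penrose A X)"

lemma mat_adjoint_carrier:
  assumes "A \<in> carrier_mat n m"
  shows "mat_adjoint A \<in> carrier_mat m n"
  using assms unfolding mat_adjoint_def by auto

lemma mat_adjoint_index:
  assumes "i < dim_col A" "j < dim_row A"
  shows "mat_adjoint A $$ (i, j) = conjugate (A $$ (j, i))"
  using assms unfolding mat_adjoint_def by (simp add: mat_of_rows_def)

lemma mat_adjoint_mult:
  fixes A B :: "complex mat"
  assumes "A \<in> carrier_mat n k" "B \<in> carrier_mat k m"
  shows "mat_adjoint (A * B) = mat_adjoint B * mat_adjoint A"
proof (rule eq_matI)
  have cA: "mat_adjoint A \<in> carrier_mat k n" and cB: "mat_adjoint B \<in> carrier_mat m k"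
    and cAB: "mat_adjoint (A * B) \<in> carrier_mat m n"
    using mat_adjoint_carrier[OF assms(1)] mat_adjoint_carrier[OF assms(2)]
      mat_adjoint_carrier[OF mult_carrier_mat[OF assms]] .
  show "dim_row (mat_adjoint (A * B)) = dim_row (mat_adjoint B * mat_adjoint A)"
    "dim_col (mat_adjoint (A * B)) = dim_col (mat_adjoint B * mat_adjoint A)"
    using cA cB cAB by auto
  fix i j
  assume "i < dim_row (mat_adjoint B * mat_adjoint A)"
    and "j < dim_col (mat_adjoint B * mat_adjoint A)"
  then have i: "i < m" and j: "j < n" using cA cB by auto
  have "mat_adjoint (A * B) $$ (i, j) = cnj (\<Sum>l<k. A $$ (j, l) * B $$ (l, i))"
    using i j assms by (simp add: mat_adjoint_index scalar_prod_def atLeast0LessThan)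
  also have "\<dots> = (\<Sum>l<k. mat_adjoint B $$ (i, l) * mat_adjoint A $$ (l, j))"
    using i j assms by (simp add: mat_adjoint_index mult.commute)
  also have "\<dots> = (mat_adjoint B * mat_adjoint A) $$ (i, j)"
    using i j cA cB by (simp add: scalar_prod_def atLeast0LessThan)
  finally show "mat_adjoint (A * B) $$ (i, j) = (mat_adjoint B * mat_adjoint A) $$ (i, j)" .
qed

lemma is_moore_penrose_unique:
  assumes X: "is_moore_penrose A X" and Y: "is_moore_penrose A Y"
  shows "X = Y"
proof -
  define n m where "n = dim_row A" and "m = dim_col A"
  have cA: "A \<in> carrier_mat n m" by (auto simp: n_def m_def)
  have cX: "X \<in> carrier_mat m n" and cY: "Y \<in> carrier_mat m n"
    using X Y by (auto simp: is_moore_penrose_def n_def m_def)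
  note cs = mult_carrier_mat[OF cA cX] mult_carrier_mat[OF cA cY]
    mult_carrier_mat[OF cX cA] mult_carrier_mat[OF cY cA]
  have x: "A * X * A = A" "X * A * X = X"
      "mat_adjoint (A * X) = A * X" "mat_adjoint (X * A) = X * A"
    and y: "A * Y * A = A" "Y * A * Y = Y"
      "mat_adjoint (A * Y) = A * Y" "mat_adjoint (Y * A) = Y * A"
    using X Y by (auto simp: is_moore_penrose_def)
  have "A * X = (A * Y) * (A * X)"
    using y(1) assoc_mult_mat[OF cs(2) cA cX] by simp
  then have "A * X = mat_adjoint ((A * Y) * (A * X))" using x(3) by simp
  also have "\<dots> = (A * X) * (A * Y)"
    using mat_adjoint_mult[OF cs(2) cs(1)] x(3) y(3) by simp
  also have "\<dots> = A * Y"
    using x(1) assoc_mult_mat[OF cs(1) cA cY] by simp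
  finally have e1: "A * X = A * Y" .
  have "X * A = (X * A) * (Y * A)"
    using y(1) assoc_mult_mat[OF cX cA cs(4)] assoc_mult_mat[OF cA cY cA] by simp
  then have "X * A = mat_adjoint ((X * A) * (Y * A))" using x(4) by simp
  also have "\<dots> = (Y * A) * (X * A)"
    using mat_adjoint_mult[OF cs(3) cs(4)] x(4) y(4) by simp
  also have "\<dots> = Y * A"
    using x(1) assoc_mult_mat[OF cY cA cs(3)] assoc_mult_mat[OF cA cX cA] by simp
  finally have e2: "X * A = Y * A" .
  have "X = (Y * A) * X" using x(2) e2 by simp
  also have "\<dots> = Y * (A * Y)" using assoc_mult_mat[OF cY cA cX] e1 by simp
  also have "\<dots> = Y" using y(2) assoc_mult_mat[OF cY cA cY] by simp
  finally show ?thesis .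
qed

lemma moore_penrose_inverse_eqI:
  "is_moore_penrose A X \<Longrightarrow> moore_penrose_inverse A = X"
  unfolding moore_penrose_inverse_def
  by (rule the_equality) (auto intro: is_moore_penrose_unique)


section \<open>Oriented graphs, their cycles and spanning trees\<close>

locale oriented_graph = digraph +
  assumes no_opposite_arcs: "(u, v) \<in> arcs_ends G \<Longrightarrow> (v, u) \<notin> arcs_ends G"

abbreviation weakly_connected :: "('a, 'b) pre_digraph \<Rightarrow> bool" where
  "weakly_connected \<equiv> Digraph_Component.connected"

abbreviation underlying :: "('a, 'b) pre_digraph \<Rightarrow> ('a, 'a \<times> 'a) pre_digraph" where
  "underlying H \<equiv> with_proj (mk_symmetric H)"

text \<open>
  The underlying graph is represented as a symmetric digraph, in which the library's
  \<^const>\<open>pre_digraph.cycle\<close> also covers walks u, v, u along a single edge. The length condition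
  removes them. Walks and cycles are lists of pairs of adjacent vertices, so the
  parity of a cycle is that of the length of the list.
\<close>
definition ucycle :: "('a, 'b) pre_digraph \<Rightarrow> ('a \<times> 'a) awalk \<Rightarrow> bool" where
  "ucycle H p \<longleftrightarrow> pre_digraph.cycle (underlying H) p \<and> 3 \<le> length p"

text \<open>
  The library's \<^const>\<open>tree\<close> and \<^const>\<open>spanning_tree\<close> only exclude directed cycles and are
  therefore not the notions for the underlying undirected graph.
\<close>
definition oriented_tree :: "('a, 'b) pre_digraph \<Rightarrow> bool" where
  "oriented_tree T \<longleftrightarrow> weakly_connected T \<and> (\<nexists>p. ucycle T p)"

definition oriented_spanning_trees :: "('a, 'b) pre_digraph \<Rightarrow> ('a, 'b) pre_digraph set" where
  "oriented_spanning_trees G = {T. spanning T G \<and> oriented_tree T}"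

definition tree_path :: "('a, 'b) pre_digraph \<Rightarrow> 'a \<Rightarrow> 'a \<Rightarrow> ('a \<times> 'a) awalk" where
  "tree_path T u v = (THE p. pre_digraph.apath (underlying T) u p v)"

definition graph_dist :: "('a, 'b) pre_digraph \<Rightarrow> 'a \<Rightarrow> 'a \<Rightarrow> nat" where
  "graph_dist H u v = (LEAST k. \<exists>p. pre_digraph.awalk (underlying H) u p v \<and> length p = k)"

definition edge_dist :: "('a, 'b) pre_digraph \<Rightarrow> 'b \<Rightarrow> 'a \<Rightarrow> nat" where
  "edge_dist H e j = min (graph_dist H (tail H e) j) (graph_dist H (head H e) j)"

definition tail_component :: "('a, 'b) pre_digraph \<Rightarrow> 'b \<Rightarrow> 'a set" where
  "tail_component T e = pre_digraph.scc_of (underlying (pre_digraph.del_arc T e)) (tail T e)"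

definition head_component :: "('a, 'b) pre_digraph \<Rightarrow> 'b \<Rightarrow> 'a set" where
  "head_component T e = pre_digraph.scc_of (underlying (pre_digraph.del_arc T e)) (head T e)"


section \<open>Weights and incidence matrices\<close>

definition pos_reals :: "complex set" where
  "pos_reals = complex_of_real ` {0<..}"

definition neg_reals :: "complex set" where
  "neg_reals = complex_of_real ` {..<0}"

text \<open>
  A weight function \<open>w\<close> assigns \<open>w u v\<close> to the arc from \<open>u\<close> to \<open>v\<close>; its values at
  pairs that are not arcs of the graph are irrelevant.
\<close>
definition arc_weight :: "('a, 'b) pre_digraph \<Rightarrow> ('a \<Rightarrow> 'a \<Rightarrow> complex) \<Rightarrow> 'b \<Rightarrow> complex" where
  "arc_weight H w e = w (tail H e) (head H e)"

definition adj_weight :: "('a, 'b) pre_digraph \<Rightarrow> ('a \<Rightarrow> 'a \<Rightarrow> complex) \<Rightarrow> 'a \<Rightarrow> 'a \<Rightarrow> complex" where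
  "adj_weight H w i j =
     (if (i, j) \<in> arcs_ends H then w i j
      else if (j, i) \<in> arcs_ends H then cnj (w j i)
      else 0)"

definition walk_weight ::
  "('a, 'b) pre_digraph \<Rightarrow> ('a \<Rightarrow> 'a \<Rightarrow> complex) \<Rightarrow> ('a \<times> 'a) awalk \<Rightarrow> complex" where
  "walk_weight H w p = (\<Prod>(i, j)\<leftarrow>p. adj_weight H w i j)"

definition graph_weight :: "('a, 'b) pre_digraph \<Rightarrow> ('a \<Rightarrow> 'a \<Rightarrow> complex) \<Rightarrow> complex" where
  "graph_weight H w = (\<Prod>e\<in>arcs H. arc_weight H w e)"

text \<open>
  Vertices and arcs are labelled by natural numbers from 0 on, like the indices of the matrix
  library. Row \<open>i\<close> belongs to vertex \<open>i\<close>, so the vertex set has to be \<open>{..<n}\<close> for some \<open>n\<close>.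
  The columns belong to the arcs in increasing order of their labels: the arc set of a subgraph,
  which keeps the labels of the whole graph, may have gaps. The column of an arc is its
  position in that order, given by \<open>arc_index\<close>. If the arc set is \<open>{..<m}\<close>, this is the label itself.
\<close>
definition signless_incidence :: "(nat, nat) pre_digraph \<Rightarrow> (nat \<Rightarrow> nat \<Rightarrow> complex) \<Rightarrow> complex mat" where
  "signless_incidence H w = mat (card (verts H)) (card (arcs H)) (\<lambda>(i, k).
     let e = sorted_list_of_set (arcs H) ! k in
       if i = tail H e then csqrt (arc_weight H w e)
       else if i = head H e then csqrt (cnj (arc_weight H w e))
       else 0)"

definition arc_index :: "(nat, nat) pre_digraph \<Rightarrow> nat \<Rightarrow> nat" where
  "arc_index H e = card {a \<in> arcs H. a < e}"

end

theory Submission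
  imports Defs
begin

text \<open>
  The cycle conditions say that the product of \<open>- a\<^sub>i\<^sub>j / |a\<^sub>i\<^sub>j|\<close> along every closed walk is 1, so these
  unit numbers have a potential \<open>\<phi>\<close>. It turns \<open>N\<close> into \<open>D\<^sup>* B S\<close>, where \<open>D = diag \<phi>\<close> is unitary, \<open>B\<close> is
  the ordinary oriented incidence matrix and \<open>S\<close> is diagonal with \<open>|s\<^sub>e|\<^sup>2 = |w\<^sub>e|\<close>. For a spanning tree
  \<open>T\<close> let \<open>f\<^sub>T(e, j)\<close> be the flow along \<open>e\<close> in \<open>T\<close> that carries one unit from \<open>j\<close> to the uniform
  distribution on the vertices. The mean \<open>F\<close> of the \<open>f\<^sub>T\<close> with weights \<open>|W\<^sub>T|\<close> satisfies \<open>B F = I - J/n\<close>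
  and \<open>F J = 0\<close>, and then \<open>S\<^sup>-\<^sup>1 F D\<close> is the Moore--Penrose inverse of \<open>N\<close> as soon as
  \<open>(F B)\<^sub>e\<^sub>f |w\<^sub>f|\<close> is symmetric in \<open>e\<close> and \<open>f\<close>. This symmetry is the exchange \<open>T \<mapsto> T - e + f\<close>, which is
  a bijection and multiplies \<open>|W\<^sub>T|\<close> by \<open>|w\<^sub>f| / |w\<^sub>e|\<close>. A tree is handled through cuts: it is a minimal
  set of arcs that crosses every nontrivial vertex set.
\<close>

section \<open>Spanning trees and cuts\<close>

context pre_digraph
begin

definition crosses :: "'a set \<Rightarrow> 'b \<Rightarrow> bool" where
  "crosses S e \<longleftrightarrow> (tail G e \<in> S) \<noteq> (head G e \<in> S)"

text \<open>Connectedness is encoded by cuts instead of walks because cuts behave linearly: a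
  symmetric difference of vertex sets is crossed by exactly the arcs that cross one of the two.
  \<open>weakly_connected_iff\<close> makes the link with walks.\<close>

definition cut_connected :: "'b set \<Rightarrow> bool" where
  "cut_connected A \<longleftrightarrow>
     (\<forall>S\<subseteq>verts G. (\<forall>e\<in>A. \<not> crosses S e) \<longrightarrow> S = {} \<or> S = verts G)"

text \<open>Minimality is given by a witness: \<open>S\<close> is a fundamental cut of
  \<open>e\<close>, one of the two sides that remain when \<open>e\<close> is deleted.
  \<open>oriented_tree_iff\<close> identifies this with acyclicity.\<close>

definition cut_tree :: "'b set \<Rightarrow> bool" where
  "cut_tree A \<longleftrightarrow> cut_connected A \<and>
     (\<forall>e\<in>A. \<exists>S\<subseteq>verts G. crosses S e \<and> (\<forall>a\<in>A - {e}. \<not> crosses S a))"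

definition is_tail_side :: "'b set \<Rightarrow> 'b \<Rightarrow> 'a set \<Rightarrow> bool" where
  "is_tail_side A e S \<longleftrightarrow> S \<subseteq> verts G \<and> tail G e \<in> S \<and> head G e \<notin> S \<and>
     (\<forall>a\<in>A - {e}. \<not> crosses S a)"

text \<open>For trees the description is meaningful: \<open>is_tail_side_tail_side\<close> gives
  existence, \<open>is_tail_side_unique\<close> uniqueness.\<close>

definition tail_side :: "'b set \<Rightarrow> 'b \<Rightarrow> 'a set" where
  "tail_side A e = (THE S. is_tail_side A e S)"

definition incidence :: "'a \<Rightarrow> 'b \<Rightarrow> complex" where
  "incidence i e = of_bool (i = tail G e) - of_bool (i = head G e)"

text \<open>Of the unit that starts at \<open>j\<close>, the share of the vertices beyond
  \<open>e\<close> has to pass \<open>e\<close>, counted positively from tail to head. This is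
  \<open>1 - |P| / n\<close> from inside the tail side \<open>P\<close> and \<open>- |P| / n\<close>
  from outside.\<close>

definition tree_flow :: "'b set \<Rightarrow> 'b \<Rightarrow> 'a \<Rightarrow> complex" where
  "tree_flow A e j =
     (if e \<in> A
      then of_bool (j \<in> tail_side A e) - of_nat (card (tail_side A e)) / of_nat (card (verts G))
      else 0)"

definition trees :: "'b set set" where
  "trees = {A. A \<subseteq> arcs G \<and> cut_tree A}"

definition mean_flow :: "('b \<Rightarrow> complex) \<Rightarrow> 'b \<Rightarrow> 'a \<Rightarrow> complex" where
  "mean_flow c e j =
     (\<Sum>A\<in>trees. (\<Prod>a\<in>A. c a) * tree_flow A e j) / (\<Sum>A\<in>trees. \<Prod>a\<in>A. c a)"

lemma crosses_sym_diff:
  "crosses (sym_diff S R) e \<longleftrightarrow> crosses S e \<noteq> crosses R e"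
  by (auto simp: crosses_def)

lemma cut_connectedD:
  assumes "cut_connected A" "S \<subseteq> verts G" "\<And>e. e \<in> A \<Longrightarrow> \<not> crosses S e"
  shows "S = {} \<or> S = verts G"
  using assms by (auto simp: cut_connected_def)

text \<open>Both sets separate the ends of \<open>e\<close> in the same direction and are crossed by
  no other arc of \<open>A\<close>, so their symmetric difference is uncrossed and hence trivial. It
  misses the tail of \<open>e\<close>, so it is empty.\<close>

lemma is_tail_side_unique:
  assumes A: "cut_connected A" and S: "is_tail_side A e S" and R: "is_tail_side A e R"
  shows "S = R"
proof -
  have "sym_diff S R = {} \<or> sym_diff S R = verts G"
  proof (rule cut_connectedD[OF A])
    show "sym_diff S R \<subseteq> verts G" using S R by (auto simp: is_tail_side_def)
    show "\<not> crosses (sym_diff S R) a" if "a \<in> A" for a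
      using that S R by (cases "a = e") (auto simp: is_tail_side_def crosses_def)
  qed
  then show ?thesis using S R by (auto simp: is_tail_side_def)
qed

end

context wf_digraph
begin

lemma crosses_compl:
  assumes "e \<in> arcs G"
  shows "crosses (verts G - S) e \<longleftrightarrow> crosses S e"
  using assms by (auto simp: crosses_def)

text \<open>A set and its complement are crossed by the same arcs, and one of the two contains the
  tail of \<open>e\<close>.\<close>

lemma is_tail_side_compl:
  assumes A: "A \<subseteq> arcs G" "e \<in> arcs G" and S: "S \<subseteq> verts G" "crosses S e"
    "\<And>a. a \<in> A - {e} \<Longrightarrow> \<not> crosses S a"
  shows "is_tail_side A e (if tail G e \<in> S then S else verts G - S)"
proof (cases "tail G e \<in> S")
  case True
  then show ?thesis using S by (auto simp: is_tail_side_def crosses_def)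
next
  case False
  have "\<not> crosses (verts G - S) a" if "a \<in> A - {e}" for a
    using S(3)[OF that] crosses_compl[of a S] that A by blast
  then show ?thesis using False S A by (auto simp: is_tail_side_def crosses_def)
qed

lemma is_tail_side_tail_side:
  assumes A: "cut_tree A" "A \<subseteq> arcs G" and e: "e \<in> A"
  shows "is_tail_side A e (tail_side A e)"
proof -
  obtain S where S: "S \<subseteq> verts G" "crosses S e" "\<And>a. a \<in> A - {e} \<Longrightarrow> \<not> crosses S a"
    using A e unfolding cut_tree_def by blast
  have "e \<in> arcs G" using A e by blast
  from is_tail_side_compl[OF A(2) this S] obtain R where "is_tail_side A e R" by blast
  then show ?thesis
    unfolding tail_side_def using A is_tail_side_unique cut_tree_def by (metis (no_types, lifting) theI)
qed

lemma tail_side_eqI: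
  assumes "cut_tree A" "is_tail_side A e S"
  shows "tail_side A e = S"
  unfolding tail_side_def
  using assms is_tail_side_unique by (auto simp: cut_tree_def intro!: the_equality)

lemma tail_side_facts:
  assumes "cut_tree A" "A \<subseteq> arcs G" "e \<in> A"
  shows "tail_side A e \<subseteq> verts G" "tail G e \<in> tail_side A e" "head G e \<notin> tail_side A e"
    "a \<in> A \<Longrightarrow> crosses (tail_side A e) a \<longleftrightarrow> a = e"
  using is_tail_side_tail_side[OF assms] by (auto simp: is_tail_side_def crosses_def)

text \<open>Basis exchange: any arc across the fundamental cut of \<open>e\<close> can replace
  \<open>e\<close>. The only nontrivial sets that \<open>A - {e}\<close> leaves uncrossed are the
  two sides of this cut, and \<open>e'\<close> crosses them. The other fundamental cuts are repaired
  by a symmetric difference with this one.\<close>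

lemma cut_tree_exchange:
  assumes A: "cut_tree A" "A \<subseteq> arcs G" and e: "e \<in> A"
    and e': "e' \<in> arcs G" "crosses (tail_side A e) e'"
  shows "cut_tree (insert e' (A - {e}))"
proof -
  let ?P = "tail_side A e"
  note P = tail_side_facts[OF A e]
  show ?thesis
    unfolding cut_tree_def
  proof (intro conjI ballI)
    show "cut_connected (insert e' (A - {e}))"
      unfolding cut_connected_def
    proof (intro allI impI)
      fix S assume S: "S \<subseteq> verts G" and nc: "\<forall>a\<in>insert e' (A - {e}). \<not> crosses S a"
      show "S = {} \<or> S = verts G"
      proof (cases "crosses S e")
        case False
        then show ?thesis using A S nc by (intro cut_connectedD[of A]) (auto simp: cut_tree_def)
      next
        case True
        \<comment> \<open>Among the arcs of \<open>A\<close>, both \<open>S\<close> and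
          \<open>?P\<close> are crossed by \<open>e\<close> alone, so the crossings cancel.\<close>
        have "sym_diff S ?P = {} \<or> sym_diff S ?P = verts G"
        proof (rule cut_connectedD)
          show "cut_connected A" using A by (simp add: cut_tree_def)
          show "sym_diff S ?P \<subseteq> verts G" using S P(1) by blast
          fix a assume "a \<in> A"
          then show "\<not> crosses (sym_diff S ?P) a"
            using True nc P(4) by (cases "a = e") (auto simp: crosses_sym_diff)
        qed
        then have "S = ?P \<or> S = verts G - ?P" using S P(1) by blast
        then have "crosses S e'" using e' crosses_compl by metis
        then show ?thesis using nc by blast
      qed
    qed
    fix f assume f: "f \<in> insert e' (A - {e})"
    show "\<exists>S\<subseteq>verts G. crosses S f \<and> (\<forall>a\<in>insert e' (A - {e}) - {f}. \<not> crosses S a)"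
    proof (cases "f = e'")
      case True
      then show ?thesis using P e' by (intro exI[of _ ?P]) auto
    next
      case False
      then have fA: "f \<in> A" "f \<noteq> e" using f by auto
      note Q = tail_side_facts[OF A fA(1)]
      let ?Q = "tail_side A f"
      show ?thesis
      proof (cases "crosses ?Q e'")
        case True
        \<comment> \<open>Since \<open>e'\<close> crosses both cuts, it does not cross their
          symmetric difference, whereas \<open>f\<close> crosses only \<open>?Q\<close>.\<close>
        show ?thesis
        proof (intro exI[of _ "sym_diff ?Q ?P"] conjI ballI)
          show "sym_diff ?Q ?P \<subseteq> verts G" using P(1) Q(1) by blast
          show "crosses (sym_diff ?Q ?P) f" using P(4) Q(4) fA by (auto simp: crosses_sym_diff)
          show "\<not> crosses (sym_diff ?Q ?P) a" if "a \<in> insert e' (A - {e}) - {f}" for a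
            using that True P(4) Q(4) e' fA by (auto simp: crosses_sym_diff)
        qed
      next
        case nc: False
        then show ?thesis using Q fA by (intro exI[of _ ?Q]) auto
      qed
    qed
  qed
qed

text \<open>The exchange keeps the cut and changes at most its orientation: no arc of
  \<open>A - {e}\<close> crosses the old side, but \<open>e'\<close> does.\<close>

lemma tail_side_exchange:
  assumes A: "cut_tree A" "A \<subseteq> arcs G" and e: "e \<in> A"
    and e': "e' \<in> arcs G" "crosses (tail_side A e) e'"
  shows "tail_side (insert e' (A - {e})) e' =
    (if tail G e' \<in> tail_side A e then tail_side A e else verts G - tail_side A e)"
  using tail_side_facts[OF A e] A e e'
  by (intro tail_side_eqI cut_tree_exchange is_tail_side_compl) auto

text \<open>A connected arc set of least cardinality is a tree: deleting an arc disconnects it, and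
  a set that shows this is crossed by the deleted arc alone.\<close>

lemma trees_nonempty:
  assumes fin: "finite (arcs G)" and conn: "cut_connected (arcs G)"
  shows "trees \<noteq> {}"
proof -
  define C where "C = {A. A \<subseteq> arcs G \<and> cut_connected A}"
  have "finite C" "C \<noteq> {}"
    using fin conn by (auto simp: C_def intro: finite_subset[of _ "Pow (arcs G)"])
  then obtain A where A: "A \<in> C" and min: "\<And>B. B \<in> C \<Longrightarrow> card A \<le> card B"
    using ex_min_if_finite[of "card ` C"] by (metis finite_imageI image_is_empty imageE imageI not_le)
  have "cut_tree A"
    unfolding cut_tree_def
  proof (intro conjI ballI)
    show "cut_connected A" using A by (simp add: C_def)
    fix e assume e: "e \<in> A"
    have "finite A" using A fin finite_subset by (auto simp: C_def)
    then have "card (A - {e}) < card A" using e by (rule card_Diff1_less)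
    then have "A - {e} \<notin> C" using min[of "A - {e}"] by linarith
    then obtain S where S: "S \<subseteq> verts G" "\<forall>a\<in>A - {e}. \<not> crosses S a" "S \<noteq> {}" "S \<noteq> verts G"
      using A by (auto simp: C_def cut_connected_def)
    moreover have "crosses S e"
      using cut_connectedD[of A S] S A by (auto simp: C_def)
    ultimately show "\<exists>S\<subseteq>verts G. crosses S e \<and> (\<forall>a\<in>A - {e}. \<not> crosses S a)" by blast
  qed
  then show ?thesis using A by (auto simp: C_def trees_def)
qed

text \<open>The level set of \<open>f\<close> through \<open>i\<close> is crossed by no arc of
  \<open>A\<close>.\<close>

lemma cut_connected_const:
  fixes f :: "'a \<Rightarrow> 'c"
  assumes A: "cut_connected A" "A \<subseteq> arcs G" and f: "\<And>e. e \<in> A \<Longrightarrow> f (tail G e) = f (head G e)"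
    and ij: "i \<in> verts G" "j \<in> verts G"
  shows "f i = f j"
proof -
  have "{x \<in> verts G. f x = f i} = {} \<or> {x \<in> verts G. f x = f i} = verts G"
    using A f by (intro cut_connectedD[OF A(1)]) (auto simp: crosses_def subset_iff)
  moreover have "i \<in> {x \<in> verts G. f x = f i}" using ij by simp
  ultimately have "j \<in> {x \<in> verts G. f x = f i}" using ij by auto
  then show ?thesis by simp
qed

end

section \<open>Flows in trees and their weighted mean\<close>

context fin_digraph
begin

lemma finite_trees [simp]: "finite trees"
  by (rule finite_subset[of _ "Pow (arcs G)"]) (auto simp: trees_def)

text \<open>This is \<open>B F = I - J/n\<close> for one tree. The indicators of the tail sides
  alone give \<open>I\<close> up to a constant in \<open>j\<close>; the second term of
  \<open>tree_flow\<close> subtracts the mean over all vertices and so removes that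
  constant.\<close>

lemma incidence_tree_flow:
  assumes A: "A \<in> trees" and ij: "i \<in> verts G" "j \<in> verts G"
  shows "(\<Sum>e\<in>A. incidence i e * tree_flow A e j) = of_bool (i = j) - 1 / of_nat (card (verts G))"
proof -
  have A: "cut_tree A" "A \<subseteq> arcs G" using A by (auto simp: trees_def)
  then have fin: "finite A" using finite_subset finite_arcs by blast
  let ?V = "verts G" and ?n = "of_nat (card (verts G)) :: complex"
  have n: "?n \<noteq> 0" using ij by (auto simp: card_eq_0_iff)
  define g :: "'b \<Rightarrow> 'a \<Rightarrow> complex" where "g e j = of_bool (j \<in> tail_side A e)" for e j
  define h where "h j = (\<Sum>e\<in>A. incidence i e * g e j)" for j
  have const: "h a - of_bool (i = a) = h b - of_bool (i = b)" if "a \<in> ?V" "b \<in> ?V" for a b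
  proof (rule cut_connected_const[OF _ A(2) _ that])
    show "cut_connected A" using A by (simp add: cut_tree_def)
    fix e' assume e': "e' \<in> A"
    \<comment> \<open>The ends of \<open>e'\<close> lie on the same side of every other tree arc;
      only the cut of \<open>e'\<close> separates them.\<close>
    have d: "g e (tail G e') - g e (head G e') = of_bool (e = e')" if "e \<in> A" for e
      using tail_side_facts[OF A that] e' by (auto simp: g_def crosses_def)
    have "h (tail G e') - h (head G e') =
        (\<Sum>e\<in>A. incidence i e * (g e (tail G e') - g e (head G e')))"
      by (simp add: h_def sum_subtractf right_diff_distrib)
    also have "\<dots> = (\<Sum>e\<in>A. if e = e' then incidence i e else 0)"
      by (intro sum.cong refl) (simp add: d)
    also have "\<dots> = incidence i e'" using fin e' by simp
    finally show "h (tail G e') - of_bool (i = tail G e') = h (head G e') - of_bool (i = head G e')"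
      by (simp add: incidence_def algebra_simps)
  qed
  \<comment> \<open>Counting the tail side as a sum over vertices exhibits the subtracted term as a
    mean.\<close>
  have card_side: "of_nat (card (tail_side A e)) = (\<Sum>l\<in>?V. g e l)" if "e \<in> A" for e
    using tail_side_facts(1)[OF A that] by (simp add: g_def Int_absorb1)
  have "(\<Sum>e\<in>A. incidence i e * tree_flow A e j) =
      (\<Sum>e\<in>A. incidence i e * (g e j - (\<Sum>l\<in>?V. g e l) / ?n))"
    by (intro sum.cong refl) (simp add: tree_flow_def card_side, simp add: g_def)
  also have "\<dots> = h j - (\<Sum>e\<in>A. incidence i e * (\<Sum>l\<in>?V. g e l)) / ?n"
    by (simp add: h_def right_diff_distrib sum_subtractf flip: sum_divide_distrib)
  also have "(\<Sum>e\<in>A. incidence i e * (\<Sum>l\<in>?V. g e l)) = (\<Sum>l\<in>?V. h l)"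
    unfolding h_def sum_distrib_left by (rule sum.swap)
  \<comment> \<open>Every \<open>h l\<close> is expressed through the fixed \<open>h j\<close>,
    which then cancels.\<close>
  also have "(\<Sum>l\<in>?V. h l) = (\<Sum>l\<in>?V. h j - of_bool (i = j) + of_bool (i = l))"
    using const[OF _ ij(2)] by (intro sum.cong refl) (simp add: algebra_simps)
  also have "\<dots> = ?n * (h j - of_bool (i = j)) + 1"
  proof -
    have "(\<Sum>l\<in>?V. of_bool (i = l) :: complex) = 1"
      using ij(1) by (simp add: of_bool_def)
    then show ?thesis by (simp add: sum.distrib)
  qed
  also have "h j - (?n * (h j - of_bool (i = j)) + 1) / ?n = of_bool (i = j) - 1 / ?n"
    using n by (simp add: field_simps)
  finally show ?thesis .
qed

lemma sum_tree_flow: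
  assumes A: "A \<in> trees"
  shows "(\<Sum>j\<in>verts G. tree_flow A e j) = 0"
proof (cases "e \<in> A")
  case True
  with A have P: "tail_side A e \<subseteq> verts G" "tail G e \<in> verts G"
    using tail_side_facts(1)[of A e] by (auto simp: trees_def)
  then have "card (verts G) \<noteq> 0" by (auto simp: card_eq_0_iff)
  moreover have "(\<Sum>j\<in>verts G. of_bool (j \<in> tail_side A e) :: complex) = of_nat (card (tail_side A e))"
    using P by (simp add: Int_absorb1)
  ultimately show ?thesis using True by (simp add: tree_flow_def sum_subtractf)
qed (simp add: tree_flow_def)

text \<open>Contributions come only from trees that contain the first arc and whose cut there is
  crossed by the second. Exchanging the arcs matches the contributing trees of both sides; the
  products trade \<open>c e\<close> for \<open>c e'\<close>, which the outer factors compensate. The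
  flow difference is 1 or -1 according to whether the two arcs cross the common cut in the same
  direction, a condition symmetric in them.\<close>

lemma tree_flow_exchange:
  fixes c :: "'b \<Rightarrow> complex"
  assumes e: "e \<in> arcs G" "e' \<in> arcs G"
  shows "c e' * (\<Sum>A\<in>trees. (\<Prod>a\<in>A. c a) * (tree_flow A e (tail G e') - tree_flow A e (head G e')))
       = c e * (\<Sum>A\<in>trees. (\<Prod>a\<in>A. c a) * (tree_flow A e' (tail G e) - tree_flow A e' (head G e)))"
proof (cases "e = e'")
  case ne: False
  define R where "R x y = {A \<in> trees. x \<in> A \<and> crosses (tail_side A x) y}" for x y
  define D where "D A x y = tree_flow A x (tail G y) - tree_flow A x (head G y)" for A x y
  have D: "D A x y = of_bool (tail G y \<in> tail_side A x) - of_bool (head G y \<in> tail_side A x)"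
    if "x \<in> A" for A x y
    using that by (simp add: D_def tree_flow_def)
  \<comment> \<open>A tree without \<open>x\<close> has flow 0 on \<open>x\<close>, and if
    \<open>y\<close> does not cross the cut of \<open>x\<close>, the flow takes the same value at
    both ends of \<open>y\<close>.\<close>
  have restrict: "(\<Sum>A\<in>trees. (\<Prod>a\<in>A. c a) * D A x y) = (\<Sum>A\<in>R x y. (\<Prod>a\<in>A. c a) * D A x y)" for x y
  proof (rule sum.mono_neutral_right)
    show "\<forall>A\<in>trees - R x y. (\<Prod>a\<in>A. c a) * D A x y = 0"
      by (auto simp: R_def D_def tree_flow_def crosses_def)
  qed (auto simp: R_def)
  \<comment> \<open>The arcs \<open>x\<close> and \<open>y\<close> are variable so that these facts
    serve both directions of the bijection.\<close>
  have step: "insert y (A - {x}) \<in> R y x" "y \<notin> A" "D (insert y (A - {x})) y x = D A x y"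
    "insert x (insert y (A - {x}) - {y}) = A"
    "c y * (\<Prod>a\<in>A. c a) = c x * (\<Prod>a\<in>insert y (A - {x}). c a)"
    if xy: "x \<in> arcs G" "y \<in> arcs G" "x \<noteq> y" and A: "A \<in> R x y" for x y A
  proof -
    from A have A: "cut_tree A" "A \<subseteq> arcs G" "x \<in> A" "crosses (tail_side A x) y"
      by (auto simp: R_def trees_def)
    let ?B = "insert y (A - {x})"
    note P = tail_side_facts[OF A(1-3)]
    show y: "y \<notin> A" using P(4) A xy by auto
    have B: "cut_tree ?B" by (rule cut_tree_exchange[OF A(1-3) xy(2) A(4)])
    have side: "tail_side ?B y =
        (if tail G y \<in> tail_side A x then tail_side A x else verts G - tail_side A x)"
      by (rule tail_side_exchange[OF A(1-3) xy(2) A(4)])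
    have "crosses (tail_side A x) x" using P by (auto simp: crosses_def)
    then have "crosses (tail_side ?B y) x" using side xy crosses_compl by auto
    then show "?B \<in> R y x" using A B xy by (auto simp: R_def trees_def)
    have "tail G y \<in> verts G" "head G y \<in> verts G" "tail G x \<in> verts G" "head G x \<in> verts G"
      using xy by auto
    then show "D ?B y x = D A x y"
      using A(3,4) P side by (auto simp: D crosses_def)
    show "insert x (?B - {y}) = A" using A y by auto
    have fin: "finite A" using A finite_subset finite_arcs by blast
    show "c y * (\<Prod>a\<in>A. c a) = c x * (\<Prod>a\<in>?B. c a)"
      using y fin A(3) by (simp add: prod.remove)
  qed
  have "c e' * (\<Sum>A\<in>trees. (\<Prod>a\<in>A. c a) * D A e e') = (\<Sum>A\<in>R e e'. c e' * (\<Prod>a\<in>A. c a) * D A e e')"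
    by (simp add: restrict sum_distrib_left mult.assoc)
  also have "\<dots> = (\<Sum>A\<in>R e' e. c e * (\<Prod>a\<in>A. c a) * D A e' e)"
    by (rule sum.reindex_bij_witness[where i = "\<lambda>A. insert e (A - {e'})" and j = "\<lambda>A. insert e' (A - {e})"])
      (use step[OF e ne] step[OF e(2,1) ne[symmetric]] in auto)
  also have "\<dots> = c e * (\<Sum>A\<in>trees. (\<Prod>a\<in>A. c a) * D A e' e)"
    by (simp add: restrict sum_distrib_left mult.assoc)
  finally show ?thesis by (simp add: D_def)
qed simp

context
  fixes c :: "'b \<Rightarrow> complex"
  assumes W: "(\<Sum>A\<in>trees. \<Prod>a\<in>A. c a) \<noteq> 0"
begin

lemma incidence_mean_flow:
  assumes ij: "i \<in> verts G" "j \<in> verts G"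
  shows "(\<Sum>e\<in>arcs G. incidence i e * mean_flow c e j) =
    of_bool (i = j) - 1 / of_nat (card (verts G))"
proof -
  let ?W = "\<Sum>A\<in>trees. \<Prod>a\<in>A. c a"
  have ext: "(\<Sum>e\<in>arcs G. incidence i e * tree_flow A e j) = (\<Sum>e\<in>A. incidence i e * tree_flow A e j)"
    if "A \<in> trees" for A
    using that by (intro sum.mono_neutral_right) (auto simp: trees_def tree_flow_def)
  have "(\<Sum>e\<in>arcs G. incidence i e * mean_flow c e j) =
      (\<Sum>e\<in>arcs G. \<Sum>A\<in>trees. (\<Prod>a\<in>A. c a) * (incidence i e * tree_flow A e j)) / ?W"
    by (simp add: mean_flow_def sum_divide_distrib sum_distrib_left mult.left_commute)
  also have "(\<Sum>e\<in>arcs G. \<Sum>A\<in>trees. (\<Prod>a\<in>A. c a) * (incidence i e * tree_flow A e j)) =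
      (\<Sum>A\<in>trees. (\<Prod>a\<in>A. c a) * (\<Sum>e\<in>arcs G. incidence i e * tree_flow A e j))"
    by (subst sum.swap) (simp add: sum_distrib_left)
  also have "\<dots> = ?W * (of_bool (i = j) - 1 / of_nat (card (verts G)))"
    by (simp add: ext incidence_tree_flow ij sum_distrib_right)
  finally show ?thesis using W by simp
qed

lemma sum_mean_flow: "(\<Sum>j\<in>verts G. mean_flow c e j) = 0"
proof -
  have "(\<Sum>j\<in>verts G. mean_flow c e j) =
      (\<Sum>A\<in>trees. (\<Prod>a\<in>A. c a) * (\<Sum>j\<in>verts G. tree_flow A e j)) / (\<Sum>A\<in>trees. \<Prod>a\<in>A. c a)"
    unfolding mean_flow_def sum_divide_distrib[symmetric] sum_distrib_left
    by (subst sum.swap) simp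
  then show ?thesis by (simp add: sum_tree_flow)
qed

lemma mean_flow_exchange:
  assumes "e \<in> arcs G" "e' \<in> arcs G"
  shows "c e' * (mean_flow c e (tail G e') - mean_flow c e (head G e')) =
    c e * (mean_flow c e' (tail G e) - mean_flow c e' (head G e))"
  using tree_flow_exchange[OF assms, of c]
  by (simp add: mean_flow_def flip: diff_divide_distrib sum_subtractf right_diff_distrib)

end

end

section \<open>Walks in the underlying graph\<close>

abbreviation uwalk :: "('a, 'b) pre_digraph \<Rightarrow> 'a \<Rightarrow> ('a \<times> 'a) awalk \<Rightarrow> 'a \<Rightarrow> bool" where
  "uwalk H \<equiv> pre_digraph.awalk (underlying H)"

lemma parcs_mk_symmetric_iff:
  "(a, b) \<in> parcs (mk_symmetric H) \<longleftrightarrow>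
     (\<exists>e\<in>arcs H. (tail H e = a \<and> head H e = b) \<or> (tail H e = b \<and> head H e = a))"
  by (auto simp: mk_symmetric_def)

lemma sym_parcs_mk_symmetric:
  "(a, b) \<in> parcs (mk_symmetric H) \<Longrightarrow> (b, a) \<in> parcs (mk_symmetric H)"
  by (auto simp: parcs_mk_symmetric_iff)

context wf_digraph
begin

interpretation U: pair_wf_digraph "mk_symmetric G" ..

lemma uwalk_Nil: "uwalk G u [] v \<longleftrightarrow> u = v \<and> u \<in> verts G"
  by (auto simp: U.awalk_simps)

lemma uwalk_Cons:
  "uwalk G u (x # p) v \<longleftrightarrow> x \<in> parcs (mk_symmetric G) \<and> u = fst x \<and> uwalk G (snd x) p v"
  by (auto simp: U.awalk_simps)

lemma uwalk_append:
  "uwalk G u (p @ q) v \<longleftrightarrow> (\<exists>x. uwalk G u p x \<and> uwalk G x q v)"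
  by (metis U.awalk_append_iff U.awalk_appendI)

lemma uwalk_in_verts: "uwalk G u p v \<Longrightarrow> u \<in> verts G \<and> v \<in> verts G"
  by (metis U.awalk_hd_in_verts U.awalk_last_in_verts pverts_mk_symmetric with_proj_simps(1))

lemma uwalk_verts:
  "uwalk G u p v \<Longrightarrow> pawalk_verts u p = u # map snd p"
  by (induction p arbitrary: u) (auto simp: uwalk_Cons)

lemma uwalk_last: "uwalk G u p v \<Longrightarrow> p \<noteq> [] \<Longrightarrow> snd (last p) = v"
  by (induction p arbitrary: u) (auto simp: uwalk_Cons uwalk_Nil)

text \<open>The bridge from walks to cuts: the leaving step lies over an arc across
  \<open>S\<close>, and the rest of the walk is kept for arguments about lengths and repeated
  vertices.\<close>

lemma uwalk_leaves:
  assumes "uwalk G a p b" "a \<in> S" "b \<notin> S"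
  obtains p1 x y p2 where "p = p1 @ (x, y) # p2" "x \<in> S" "y \<notin> S" "uwalk G y p2 b"
    "(x, y) \<in> parcs (mk_symmetric G)"
proof -
  have "\<exists>p1 x y p2. p = p1 @ (x, y) # p2 \<and> x \<in> S \<and> y \<notin> S \<and> uwalk G y p2 b \<and>
      (x, y) \<in> parcs (mk_symmetric G)"
    using assms
  proof (induction p arbitrary: a)
    case (Cons z p)
    show ?case
    proof (cases "snd z \<in> S")
      case True
      with Cons.prems Cons.IH[of "snd z"] obtain p1 x y p2 where "p = p1 @ (x, y) # p2" "x \<in> S" "y \<notin> S"
          "uwalk G y p2 b" "(x, y) \<in> parcs (mk_symmetric G)"
        by (simp add: uwalk_Cons) blast
      then show ?thesis by (intro exI[of _ "z # p1"]) auto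
    next
      case False
      with Cons show ?thesis by (intro exI[of _ "[]"]) (cases z, auto simp: uwalk_Cons)
    qed
  qed (auto simp: uwalk_Nil)
  then show ?thesis using that by blast
qed

lemma crosses_parcs:
  assumes "(x, y) \<in> parcs (mk_symmetric G)" "x \<in> S" "y \<notin> S"
  obtains e where "e \<in> arcs G" "crosses S e"
    "(tail G e = x \<and> head G e = y) \<or> (tail G e = y \<and> head G e = x)"
  using assms by (auto simp: parcs_mk_symmetric_iff crosses_def)

text \<open>A walk from inside a set to its outside uses a crossing arc. Conversely, the set of
  vertices reachable from \<open>u\<close> is closed under steps in both directions, so no arc
  crosses it.\<close>

lemma weakly_connected_iff:
  "weakly_connected G \<longleftrightarrow> verts G \<noteq> {} \<and> cut_connected (arcs G)"
proof (intro iffI conjI)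
  assume "weakly_connected G"
  then have con: "verts G \<noteq> {}" "u \<in> verts G \<Longrightarrow> v \<in> verts G \<Longrightarrow> \<exists>p. uwalk G u p v" for u v
    by (auto simp: connected_def strongly_connected_def U.reachable_awalk)
  then show "verts G \<noteq> {}" by simp
  show "cut_connected (arcs G)"
    unfolding cut_connected_def
  proof (intro allI impI, rule ccontr)
    fix S assume S: "S \<subseteq> verts G" "\<forall>e\<in>arcs G. \<not> crosses S e" "\<not> (S = {} \<or> S = verts G)"
    then obtain a b where ab: "a \<in> S" "b \<in> verts G" "b \<notin> S" by blast
    then obtain p where p: "uwalk G a p b" using con(2)[of a b] S(1) by blast
    show False using uwalk_leaves[OF p ab(1,3)] crosses_parcs S(2) by metis
  qed
next
  assume "verts G \<noteq> {} \<and> cut_connected (arcs G)"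
  then have ne: "verts G \<noteq> {}" and con: "cut_connected (arcs G)" by auto
  have "\<exists>p. uwalk G u p v" if u: "u \<in> verts G" and v: "v \<in> verts G" for u v
  proof -
    let ?S = "{x. \<exists>p. uwalk G u p x}"
    have step: "y \<in> ?S" if x: "x \<in> ?S" and xy: "(x, y) \<in> parcs (mk_symmetric G)" for x y
    proof -
      obtain p where p: "uwalk G u p x" using x by blast
      have "uwalk G x [(x, y)] y" using xy U.in_arcsD2 by (auto simp: uwalk_Cons uwalk_Nil)
      then have "uwalk G u (p @ [(x, y)]) y" using p uwalk_append by blast
      then show ?thesis by blast
    qed
    have "?S = {} \<or> ?S = verts G"
    proof (rule cut_connectedD[OF con])
      show "?S \<subseteq> verts G" using uwalk_in_verts by blast
      fix e assume e: "e \<in> arcs G"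
      then have "(tail G e, head G e) \<in> parcs (mk_symmetric G)" "(head G e, tail G e) \<in> parcs (mk_symmetric G)"
        by (auto simp: parcs_mk_symmetric_iff)
      then show "\<not> crosses ?S e" using step unfolding crosses_def by blast
    qed
    moreover have "u \<in> ?S" using u uwalk_Nil by blast
    ultimately show ?thesis using v by blast
  qed
  then show "weakly_connected G"
    using ne by (auto simp: connected_def strongly_connected_def U.reachable_awalk)
qed

lemma weakly_connected_uwalk:
  assumes "weakly_connected G" "u \<in> verts G" "v \<in> verts G"
  obtains p where "uwalk G u p v"
  using assms by (auto simp: connected_def strongly_connected_def U.reachable_awalk)

text \<open>By symmetry the strong components are the connected ones. The four facts single out
  \<open>C\<close> as the least uncrossed vertex set that contains \<open>x\<close>.\<close>

lemma scc_of_underlying: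
  assumes x: "x \<in> verts G"
  defines "C \<equiv> pre_digraph.scc_of (underlying G) x"
  shows "C \<subseteq> verts G" "x \<in> C" "e \<in> arcs G \<Longrightarrow> \<not> crosses C e"
    "x \<in> S \<Longrightarrow> (\<And>a. a \<in> arcs G \<Longrightarrow> \<not> crosses S a) \<Longrightarrow> C \<subseteq> S"
proof -
  have C: "C = {v. \<exists>p. uwalk G x p v}"
    unfolding C_def U.scc_of_def
    using symmetric_reachable[OF symmetric_mk_symmetric, of G] U.reachable_awalk by blast
  show "C \<subseteq> verts G" using uwalk_in_verts by (auto simp: C)
  show "x \<in> C" using x uwalk_Nil by (auto simp: C)
  have step: "b \<in> C" if a: "a \<in> C" and ab: "(a, b) \<in> parcs (mk_symmetric G)" for a b
  proof -
    obtain p where p: "uwalk G x p a" using a C by blast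
    have "uwalk G a [(a, b)] b" using ab U.in_arcsD2 by (auto simp: uwalk_Cons uwalk_Nil)
    then have "uwalk G x (p @ [(a, b)]) b" using p uwalk_append by blast
    then show ?thesis using C by blast
  qed
  show "\<not> crosses C e" if e: "e \<in> arcs G"
  proof -
    have "(tail G e, head G e) \<in> parcs (mk_symmetric G)" "(head G e, tail G e) \<in> parcs (mk_symmetric G)"
      using e by (auto simp: parcs_mk_symmetric_iff)
    then show ?thesis using step unfolding crosses_def by blast
  qed
  show "C \<subseteq> S" if "x \<in> S" "\<And>a. a \<in> arcs G \<Longrightarrow> \<not> crosses S a"
  proof
    fix v assume "v \<in> C"
    then obtain p where p: "uwalk G x p v" using C by blast
    show "v \<in> S"
    proof (rule ccontr)
      assume "v \<notin> S"
      from uwalk_leaves[OF p that(1) this] show False using crosses_parcs that(2) by metis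
    qed
  qed
qed

lemma wf_digraph_del_arc: "wf_digraph (del_arc e)"
  by unfold_locales (auto simp: del_arc_def)

lemma crosses_del_arc: "pre_digraph.crosses (del_arc e) = crosses"
  by (auto simp: fun_eq_iff pre_digraph.crosses_def del_arc_def)

text \<open>No arc other than \<open>e\<close> crosses the component. Being the least such set, it
  lies within the tail side, so it misses the head of \<open>e\<close> and is itself a tail
  side.\<close>

lemma tail_component_eq:
  assumes "cut_tree (arcs G)" "e \<in> arcs G"
  shows "tail_component G e = tail_side (arcs G) e"
proof -
  interpret D: wf_digraph "del_arc e" by (rule wf_digraph_del_arc)
  note P = tail_side_facts[OF assms(1) subset_refl assms(2)]
  have "tail G e \<in> verts (del_arc e)" using assms by (simp add: del_arc_def)
  note C = D.scc_of_underlying[OF this, unfolded crosses_del_arc]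
  have arcs: "arcs (del_arc e) = arcs G - {e}" by (simp add: del_arc_def)
  have t: "tail_component G e = pre_digraph.scc_of (underlying (del_arc e)) (tail G e)"
    by (simp add: tail_component_def)
  have "is_tail_side (arcs G) e (tail_component G e)"
    unfolding is_tail_side_def
  proof (intro conjI ballI)
    show "tail_component G e \<subseteq> verts G" "tail G e \<in> tail_component G e"
      using C(1,2) unfolding t by (auto simp: del_arc_def)
    show "\<not> crosses (tail_component G e) a" if "a \<in> arcs G - {e}" for a
      using C(3) that arcs unfolding t by blast
    have "tail_component G e \<subseteq> tail_side (arcs G) e"
      unfolding t by (rule C(4)) (use P arcs in auto)
    then show "head G e \<notin> tail_component G e" using P(3) by blast
  qed
  then show ?thesis using tail_side_eqI assms by metis
qed

text \<open>The component of the head is contained in the complement of the tail side, so it misses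
  the tail of \<open>e\<close>, and its own complement qualifies as the tail side.\<close>

lemma head_component_eq:
  assumes "cut_tree (arcs G)" "e \<in> arcs G"
  shows "head_component G e = verts G - tail_side (arcs G) e"
proof -
  interpret D: wf_digraph "del_arc e" by (rule wf_digraph_del_arc)
  note P = tail_side_facts[OF assms(1) subset_refl assms(2)]
  have "head G e \<in> verts (del_arc e)" using assms by (simp add: del_arc_def)
  note C = D.scc_of_underlying[OF this, unfolded crosses_del_arc]
  have arcs: "arcs (del_arc e) = arcs G - {e}" "verts (del_arc e) = verts G" by (simp_all add: del_arc_def)
  have t: "head_component G e = pre_digraph.scc_of (underlying (del_arc e)) (head G e)"
    by (simp add: head_component_def)
  have nc: "\<not> crosses (verts G - tail_side (arcs G) e) a" if "a \<in> arcs G - {e}" for a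
    using P(4)[of a] that crosses_compl[of a] by auto
  have sub: "head_component G e \<subseteq> verts G - tail_side (arcs G) e"
    unfolding t by (rule C(4)) (use nc arcs P assms in auto)
  have "is_tail_side (arcs G) e (if tail G e \<in> head_component G e then head_component G e
      else verts G - head_component G e)"
  proof (rule is_tail_side_compl)
    show "head_component G e \<subseteq> verts G" "\<And>a. a \<in> arcs G - {e} \<Longrightarrow> \<not> crosses (head_component G e) a"
      using C(1,3) arcs unfolding t by auto
    show "crosses (head_component G e) e"
      using C(2) sub P(2) unfolding t crosses_def by blast
  qed (use assms in auto)
  moreover have "tail G e \<notin> head_component G e" using sub P(2) by blast
  ultimately have "tail_side (arcs G) e = verts G - head_component G e"
    using tail_side_eqI assms by auto
  then show ?thesis using sub by auto
qed

end

section \<open>Trees as connected graphs without cycles\<close>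

context oriented_graph
begin

interpretation U: pair_wf_digraph "mk_symmetric G" ..

lemma opposite_ends_absurd:
  assumes "e \<in> arcs G" "f \<in> arcs G" "tail G f = head G e" "head G f = tail G e"
  shows False
  using assms no_opposite_arcs[of "tail G e" "head G e"] by (force simp: arcs_ends_conv image_iff)

lemma same_ends_eq:
  assumes "e \<in> arcs G" "f \<in> arcs G" "tail G f = tail G e" "head G f = head G e"
  shows "f = e"
  using assms no_multi_arcs by (auto simp: arc_to_ends_def)

text \<open>The fundamental cut is oriented along the step instead of the arc: \<open>S\<close> is
  the side of \<open>u\<close>. Walk arguments in trees rest on \<open>(u, x)\<close> being the only
  way out of \<open>S\<close>.\<close>

lemma directed_cut:
  assumes tree: "cut_tree (arcs G)" and ux: "(u, x) \<in> parcs (mk_symmetric G)"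
  obtains S where "u \<in> S" "x \<notin> S"
    "\<And>a b. (a, b) \<in> parcs (mk_symmetric G) \<Longrightarrow> a \<in> S \<Longrightarrow> b \<notin> S \<Longrightarrow> a = u \<and> b = x"
proof -
  obtain e where e: "e \<in> arcs G" "(tail G e = u \<and> head G e = x) \<or> (tail G e = x \<and> head G e = u)"
    using ux parcs_mk_symmetric_iff by metis
  note P = tail_side_facts[OF tree subset_refl e(1)]
  define S where "S = (if tail G e = u then tail_side (arcs G) e else verts G - tail_side (arcs G) e)"
  have cS: "crosses S a \<longleftrightarrow> a = e" if "a \<in> arcs G" for a
    using P(4)[OF that] crosses_compl[OF that] by (simp add: S_def)
  show ?thesis
  proof (rule that)
    show uS: "u \<in> S" and xS: "x \<notin> S"
      using P e no_loops[OF e(1)] e(1) head_in_verts[OF e(1)] by (auto simp: S_def)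
    fix a b assume "(a, b) \<in> parcs (mk_symmetric G)" "a \<in> S" "b \<notin> S"
    then obtain f where f: "f \<in> arcs G" "crosses S f"
      "(tail G f = a \<and> head G f = b) \<or> (tail G f = b \<and> head G f = a)"
      by (rule crosses_parcs)
    with cS have "f = e" by simp
    then show "a = u \<and> b = x" using f(3) e(2) uS xS \<open>a \<in> S\<close> \<open>b \<notin> S\<close> by auto
  qed
qed

text \<open>After its first step \<open>(u, b)\<close> a cycle has to return across the fundamental
  cut of that step, which only \<open>(b, u)\<close> does. Distinctness of the vertices then leaves
  a walk of length 2.\<close>

lemma cut_tree_imp_no_ucycle:
  assumes tree: "cut_tree (arcs G)" and cyc: "ucycle G p"
  shows False
proof -
  obtain u where p: "uwalk G u p u" "distinct (tl (pre_digraph.awalk_verts (underlying G) u p))" "3 \<le> length p"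
    using cyc by (auto simp: ucycle_def U.cycle_def)
  then obtain x q where pq: "p = x # q" by (cases p) auto
  obtain b where x: "x = (u, b)" using p pq by (cases x) (auto simp: uwalk_Cons)
  have q: "(u, b) \<in> parcs (mk_symmetric G)" "uwalk G b q u" using p pq x by (auto simp: uwalk_Cons)
  have dist: "b \<notin> snd ` set q" "distinct (map snd q)"
    using p(2) uwalk_verts[OF p(1)] unfolding awalk_verts_with_proj_eq pq x by auto
  from directed_cut[OF tree sym_parcs_mk_symmetric[OF q(1)]] obtain S where S: "b \<in> S" "u \<notin> S"
    "\<And>y z. (y, z) \<in> parcs (mk_symmetric G) \<Longrightarrow> y \<in> S \<Longrightarrow> z \<notin> S \<Longrightarrow> y = b \<and> z = u"
    by blast
  from uwalk_leaves[OF q(2) S(1,2)] obtain p1 y z p2 where q': "q = p1 @ (y, z) # p2" "uwalk G z p2 u"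
    "y = b \<and> z = u"
    using S(3) by metis
  \<comment> \<open>A further step after \<open>(b, u)\<close> would lead to \<open>u\<close> a
    second time; likewise a step before it would bring the walk back to \<open>b\<close>.\<close>
  have "p2 = []"
  proof (rule ccontr)
    assume "p2 \<noteq> []"
    then have "u \<in> snd ` set p2" using uwalk_last[OF q'(2)] by (metis imageI last_in_set)
    then show False using dist(2) q' by auto
  qed
  moreover have "p1 = []"
  proof (rule ccontr)
    assume "p1 \<noteq> []"
    have "uwalk G b p1 b" using q(2) unfolding q'(1) uwalk_append by (auto simp: uwalk_Cons q'(3))
    then have "b \<in> snd ` set p1" using uwalk_last[OF _ \<open>p1 \<noteq> []\<close>] by (metis \<open>p1 \<noteq> []\<close> imageI last_in_set)
    then show False using dist(1) q' by auto
  qed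
  ultimately show False using p(3) pq q' by simp
qed

text \<open>The cut for \<open>e\<close> is the component of its head after deletion of
  \<open>e\<close>. If it contained the tail, a path from head to tail would close up with
  \<open>e\<close> to a cycle.\<close>

lemma no_ucycle_imp_cut_tree:
  assumes con: "cut_connected (arcs G)" and acyc: "\<nexists>p. ucycle G p"
  shows "cut_tree (arcs G)"
  unfolding cut_tree_def
proof (intro conjI ballI con)
  fix e assume e: "e \<in> arcs G"
  interpret D: wf_digraph "del_arc e" by (rule wf_digraph_del_arc)
  interpret DU: pair_wf_digraph "mk_symmetric (del_arc e)" ..
  have dt: "arcs (del_arc e) = arcs G - {e}" "verts (del_arc e) = verts G"
    "tail (del_arc e) = tail G" "head (del_arc e) = head G" by (simp_all add: del_arc_def)
  define C where "C = pre_digraph.scc_of (underlying (del_arc e)) (head G e)"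
  have C: "C \<subseteq> verts G" "head G e \<in> C" "\<And>a. a \<in> arcs G - {e} \<Longrightarrow> \<not> crosses C a"
    using D.scc_of_underlying[of "head G e", folded C_def, unfolded crosses_del_arc] e dt by auto
  have "tail G e \<notin> C"
  proof
    assume "tail G e \<in> C"
    then have "head G e \<rightarrow>\<^sup>*\<^bsub>underlying (del_arc e)\<^esub> tail G e" by (simp add: C_def DU.scc_of_def)
    then obtain p where ap: "DU.apath (head G e) p (tail G e)" using DU.reachable_apath by blast
    then have p: "uwalk (del_arc e) (head G e) p (tail G e)" by (simp add: DU.apath_def)
    have subp: "parcs (mk_symmetric (del_arc e)) \<subseteq> parcs (mk_symmetric G)"
      by (auto simp: mk_symmetric_def dt)
    have w: "uwalk G (head G e) p (tail G e)"
      using p subp by (auto simp: U.awalk_def DU.awalk_def dt)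
    let ?c = "(tail G e, head G e) # p"
    have w': "uwalk G (tail G e) ?c (tail G e)"
      using w e by (auto simp: uwalk_Cons parcs_mk_symmetric_iff)
    have "distinct (head G e # map snd p)"
      using ap D.uwalk_verts[OF p] by (simp add: DU.apath_def awalk_verts_with_proj_eq)
    then have "distinct (tl (pre_digraph.awalk_verts (underlying G) (tail G e) ?c))"
      using uwalk_verts[OF w'] by (simp add: awalk_verts_with_proj_eq)
    with w' have cyc: "U.cycle ?c" unfolding U.cycle_def by (intro exI[of _ "tail G e"]) simp
    \<comment> \<open>Length 0 would make \<open>e\<close> a loop, and length 1 would require a
      second arc, parallel or opposite, between its ends.\<close>
    have "2 \<le> length p"
    proof (rule ccontr)
      assume "\<not> 2 \<le> length p"
      then consider "p = []" | x where "p = [x]" by (cases p; cases "tl p") auto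
      then show False
      proof cases
        case 1
        then show False using p no_loops[OF e] by (auto simp: D.uwalk_Nil)
      next
        case 2
        then have "(head G e, tail G e) \<in> parcs (mk_symmetric (del_arc e))"
          using p by (cases x) (auto simp: D.uwalk_Nil D.uwalk_Cons)
        then obtain f where "f \<in> arcs G" "f \<noteq> e" "(tail G f = tail G e \<and> head G f = head G e) \<or>
            (tail G f = head G e \<and> head G f = tail G e)"
          unfolding parcs_mk_symmetric_iff dt by blast
        then show False using opposite_ends_absurd[OF e] same_ends_eq[OF e] by blast
      qed
    qed
    then show False using cyc acyc by (auto simp: ucycle_def)
  qed
  then show "\<exists>S\<subseteq>verts G. crosses S e \<and> (\<forall>a\<in>arcs G - {e}. \<not> crosses S a)"
    using C by (intro exI[of _ C]) (auto simp: crosses_def)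
qed

lemma oriented_tree_iff: "oriented_tree G \<longleftrightarrow> verts G \<noteq> {} \<and> cut_tree (arcs G)"
  using cut_tree_imp_no_ucycle no_ucycle_imp_cut_tree
  by (auto simp: oriented_tree_def weakly_connected_iff cut_tree_def)

text \<open>Let \<open>S\<close> be the near side of the first step \<open>(u, x)\<close> of
  \<open>p\<close>. The target \<open>v\<close> lies beyond it, since \<open>p\<close> could return
  to \<open>S\<close> only through \<open>u\<close>. So \<open>q\<close> also has to leave
  \<open>S\<close> by \<open>(u, x)\<close>, and without revisiting \<open>u\<close> it can do so
  only at its first step.\<close>

lemma apath_unique:
  assumes tree: "cut_tree (arcs G)" and p: "U.apath u p v" and q: "U.apath u q v"
  shows "p = q"
  using p q
proof (induction p arbitrary: u q)
  case Nil
  then show ?case using U.apath_nonempty_ends[of u q v] by (auto simp: U.apath_simps)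
next
  case (Cons z p)
  obtain x where z: "z = (u, x)" using Cons.prems by (cases z) (auto simp: U.apath_simps)
  have "u \<noteq> v" using Cons.prems U.apath_nonempty_ends by blast
  then obtain z' q' where qz: "q = z' # q'" using Cons.prems by (cases q) (auto simp: U.apath_simps)
  obtain y where z': "z' = (u, y)" using Cons.prems qz by (cases z') (auto simp: U.apath_simps)
  have p: "(u, x) \<in> parcs (mk_symmetric G)" "U.apath x p v" "u \<notin> set (U.awalk_verts x p)"
    using Cons.prems z by (auto simp: U.apath_simps)
  have q: "(u, y) \<in> parcs (mk_symmetric G)" "U.apath y q' v" "u \<notin> set (U.awalk_verts y q')"
    using Cons.prems qz z' by (auto simp: U.apath_simps)
  have wp: "uwalk G x p v" and wq: "uwalk G y q' v" using p q by (auto simp: U.apath_def)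
  have up: "u \<notin> snd ` set p" and uq: "u \<noteq> y" "u \<notin> snd ` set q'"
    using p(3) q(3) by (auto simp: uwalk_verts[OF wp] uwalk_verts[OF wq] awalk_verts_with_proj_eq)
  obtain S where S: "u \<in> S" "x \<notin> S"
    "\<And>a b. (a, b) \<in> parcs (mk_symmetric G) \<Longrightarrow> a \<in> S \<Longrightarrow> b \<notin> S \<Longrightarrow> a = u \<and> b = x"
    by (rule directed_cut[OF tree p(1)]) (rule that)
  have "v \<notin> S"
  proof
    assume "v \<in> S"
    then have "x \<in> - S" "v \<notin> - S" using S(2) by auto
    from uwalk_leaves[OF wp this] obtain p1 a b p2 where l: "p = p1 @ (a, b) # p2" "a \<in> - S" "b \<notin> - S"
      "(a, b) \<in> parcs (mk_symmetric G)"
      by metis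
    then have "b = u" using S(3)[OF sym_parcs_mk_symmetric[OF l(4)]] by auto
    then show False using l up by auto
  qed
  have "x = y"
  proof (rule ccontr)
    assume "x \<noteq> y"
    then have "y \<in> S" using S(3)[OF q(1) S(1)] by blast
    from uwalk_leaves[OF wq this \<open>v \<notin> S\<close>]
    obtain p1 a b p2 where l: "q' = p1 @ (a, b) # p2" "a \<in> S" "b \<notin> S"
      "(a, b) \<in> parcs (mk_symmetric G)"
      by metis
    then have "a = u" using S(3)[OF l(4)] by auto
    moreover have "uwalk G y p1 a" using wq unfolding l(1) uwalk_append by (auto simp: uwalk_Cons)
    ultimately have ne: "p1 \<noteq> []" and "uwalk G y p1 u"
      using uq(1) by (auto simp: uwalk_Nil)
    then have "u = snd (last p1)" using uwalk_last by metis
    with ne have "u \<in> snd ` set p1" by (metis imageI last_in_set)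
    then show False using uq(2) l(1) by auto
  qed
  then show ?case using Cons.IH[OF p(2)] q(2) qz z z' by simp
qed

lemma tree_path_uwalk:
  assumes tree: "oriented_tree G" and uv: "u \<in> verts G" "v \<in> verts G"
  shows "uwalk G u (tree_path G u v) v"
proof -
  have cut: "cut_tree (arcs G)" and con: "weakly_connected G"
    using tree oriented_tree_iff by (auto simp: oriented_tree_def)
  have "\<exists>!p. U.apath u p v"
    using apath_unique[OF cut] con uv U.reachable_apath
    by (metis connected_def strongly_connected_def pverts_mk_symmetric with_proj_simps(1))
  then have "U.apath u (tree_path G u v) v" unfolding tree_path_def by (rule theI')
  then show ?thesis by (simp add: U.apath_def)
qed

section \<open>Distances in a tree\<close>

lemma graph_dist_uwalk:
  assumes "weakly_connected G" "u \<in> verts G" "v \<in> verts G"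
  obtains p where "uwalk G u p v" "length p = graph_dist G u v"
proof -
  obtain p where "uwalk G u p v" using weakly_connected_uwalk assms by blast
  then have "\<exists>k p. uwalk G u p v \<and> length p = k" by blast
  from LeastI_ex[OF this] show ?thesis using that unfolding graph_dist_def by blast
qed

lemma graph_dist_le: "uwalk G u p v \<Longrightarrow> graph_dist G u v \<le> length p"
  unfolding graph_dist_def by (rule Least_le) blast

text \<open>A shortest walk from \<open>x\<close> to \<open>j\<close> has to enter \<open>S\<close>,
  and \<open>y\<close> is the only entrance. What follows the entrance is a strictly shorter walk
  from \<open>y\<close>.\<close>

lemma graph_dist_less:
  assumes tree: "oriented_tree G" and S: "x \<notin> S" "y \<in> S" "j \<in> S" "x \<in> verts G" "j \<in> verts G"
    and cross: "\<And>a b. (a, b) \<in> parcs (mk_symmetric G) \<Longrightarrow> a \<notin> S \<Longrightarrow> b \<in> S \<Longrightarrow> b = y"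
  shows "graph_dist G y j < graph_dist G x j"
proof -
  obtain p where p: "uwalk G x p j" "length p = graph_dist G x j"
    using graph_dist_uwalk tree S unfolding oriented_tree_def by blast
  have "x \<in> - S" "j \<notin> - S" using S by auto
  from uwalk_leaves[OF p(1) this] obtain p1 a b p2 where l: "p = p1 @ (a, b) # p2" "a \<in> - S" "b \<notin> - S"
      "(a, b) \<in> parcs (mk_symmetric G)" "uwalk G b p2 j"
    by metis
  then have "b = y" using cross by auto
  then have "graph_dist G y j \<le> length p2" using l graph_dist_le by blast
  then show ?thesis using p l by simp
qed

text \<open>The tail of \<open>e\<close> is the only entrance to its side, so the minimum in
  \<open>edge_dist\<close> is attained there.\<close>

lemma edge_dist_tail:
  assumes tree: "oriented_tree G" and e: "e \<in> arcs G" and j: "j \<in> tail_component G e"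
  shows "edge_dist G e j = graph_dist G (tail G e) j"
proof -
  have cut: "cut_tree (arcs G)" using tree oriented_tree_iff by blast
  note P = tail_side_facts[OF cut subset_refl e]
  have "graph_dist G (tail G e) j < graph_dist G (head G e) j"
  proof (rule graph_dist_less[OF tree, where S = "tail_side (arcs G) e"])
    fix a b assume ab: "(a, b) \<in> parcs (mk_symmetric G)" "a \<notin> tail_side (arcs G) e" "b \<in> tail_side (arcs G) e"
    obtain f where f: "f \<in> arcs G" "crosses (tail_side (arcs G) e) f"
      "(tail G f = b \<and> head G f = a) \<or> (tail G f = a \<and> head G f = b)"
      by (rule crosses_parcs[OF sym_parcs_mk_symmetric[OF ab(1)] ab(3,2)])
    then have "f = e" using P(4) by blast
    then show "b = tail G e" using f P ab by auto
  qed (use P j e tail_component_eq[OF cut e] in auto)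
  then show ?thesis by (simp add: edge_dist_def)
qed

lemma edge_dist_head:
  assumes tree: "oriented_tree G" and e: "e \<in> arcs G" and j: "j \<in> head_component G e"
  shows "edge_dist G e j = graph_dist G (head G e) j"
proof -
  have cut: "cut_tree (arcs G)" using tree oriented_tree_iff by blast
  note P = tail_side_facts[OF cut subset_refl e]
  have "graph_dist G (head G e) j < graph_dist G (tail G e) j"
  proof (rule graph_dist_less[OF tree, where S = "- tail_side (arcs G) e"])
    fix a b assume ab: "(a, b) \<in> parcs (mk_symmetric G)" "a \<notin> - tail_side (arcs G) e" "b \<in> - tail_side (arcs G) e"
    then have "a \<in> tail_side (arcs G) e" "b \<notin> tail_side (arcs G) e" by auto
    with ab(1) obtain f where f: "f \<in> arcs G" "crosses (tail_side (arcs G) e) f"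
      "(tail G f = a \<and> head G f = b) \<or> (tail G f = b \<and> head G f = a)"
      by (rule crosses_parcs)
    then have "f = e" using P(4) by blast
    then show "b = head G e" using f P ab by auto
  qed (use P j e head_component_eq[OF cut e] in auto)
  then show ?thesis by (simp add: edge_dist_def)
qed

section \<open>Potentials\<close>

text \<open>Induction on the length: at a repeated vertex a closed walk splits into two shorter
  closed walks. Without repetition it is empty, a step back and forth (\<open>inv\<close>) or a
  cycle (\<open>cyc\<close>); a single step would be a loop.\<close>

lemma prod_closed_uwalk:
  fixes g :: "'a \<times> 'a \<Rightarrow> 'c :: comm_monoid_mult"
  assumes inv: "\<And>a b. (a, b) \<in> parcs (mk_symmetric G) \<Longrightarrow> g (a, b) * g (b, a) = 1"
    and cyc: "\<And>C. ucycle G C \<Longrightarrow> prod_list (map g C) = 1"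
    and p: "uwalk G u p u"
  shows "prod_list (map g p) = 1"
  using p
proof (induction p arbitrary: u rule: length_induct)
  case (1 p)
  show ?case
  proof (cases "distinct (map snd p)")
    case True
    consider "p = []" | x where "p = [x]" | x y where "p = [x, y]" | "3 \<le> length p"
      by (cases p; cases "tl p"; cases "tl (tl p)") auto
    then show ?thesis
    proof cases
      case 2
      then have "(u, u) \<in> parcs (mk_symmetric G)" using 1(2) by (cases x) (auto simp: uwalk_Nil uwalk_Cons)
      then show ?thesis using no_loops by (force simp: parcs_mk_symmetric_iff)
    next
      case 3
      then obtain a b where "p = [(a, b), (b, a)]" "(a, b) \<in> parcs (mk_symmetric G)"
        using 1(2) by (cases x; cases y) (auto simp: uwalk_Nil uwalk_Cons)
      then show ?thesis using inv by simp
    next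
      case 4
      have "U.cycle p"
        unfolding U.cycle_def
        using 1(2) True 4 by (intro exI[of _ u]) (auto simp: uwalk_verts awalk_verts_with_proj_eq)
      then show ?thesis using cyc 4 by (simp add: ucycle_def)
    qed simp
  next
    case False
    \<comment> \<open>Two steps \<open>x\<close> and \<open>y\<close> end at the same vertex
      \<open>a\<close>. The part after \<open>x\<close> up to and including \<open>y\<close> is
      closed, and so is the walk with that part cut out.\<close>
    then obtain xs ys zs a where "map snd p = xs @ [a] @ ys @ [a] @ zs"
      using not_distinct_decomp by blast
    then have "map snd p = xs @ a # ys @ a # zs" by simp
    note this[unfolded map_eq_append_conv]
    then obtain p1 q1 where pq: "p = p1 @ q1" "map snd q1 = a # ys @ a # zs"
      by (elim exE conjE) (rule that, simp_all)
    from pq(2) obtain x q2 where q1: "q1 = x # q2" "snd x = a" "map snd q2 = ys @ a # zs"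
      by (cases q1) auto
    from q1(3)[unfolded map_eq_append_conv] obtain p3 q3 where q2: "q2 = p3 @ q3" "map snd q3 = a # zs"
      by (elim exE conjE) (rule that, simp_all)
    from q2(2) obtain y p5 where q3: "q3 = y # p5" "snd y = a" by (cases q3) auto
    define p2 p4 where "p2 = [x]" and "p4 = [y]"
    have p: "p = p1 @ p2 @ p3 @ p4 @ p5" using pq(1) q1(1) q2(1) q3(1) by (simp add: p2_def p4_def)
    have w: "uwalk G u (p1 @ p2) a" "uwalk G a (p3 @ p4) a" "uwalk G a p5 u"
      using 1(2) q1(2) q3(2) uwalk_in_verts unfolding p p2_def p4_def
      by (auto simp: uwalk_append uwalk_Cons uwalk_Nil)
    have IH: "prod_list (map g q) = 1" if "uwalk G x q x" "length q < length p" for x q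
      using 1(1) that by blast
    have "uwalk G u ((p1 @ p2) @ p5) u" using w uwalk_append by blast
    then have "prod_list (map g ((p1 @ p2) @ p5)) = 1"
      by (rule IH) (simp add: p p2_def p4_def)
    moreover have "prod_list (map g (p3 @ p4)) = 1"
      by (rule IH[OF w(2)]) (simp add: p p2_def p4_def)
    moreover have "prod_list (map g p) = prod_list (map g ((p1 @ p2) @ p5)) * prod_list (map g (p3 @ p4))"
      unfolding p by (simp add: ac_simps)
    ultimately show ?thesis by simp
  qed
qed

text \<open>The potential at \<open>v\<close> is the product along a chosen walk from a root. Two
  closed walks through the root with the same return \<open>s\<close>, one via \<open>W v\<close>
  and one via \<open>W u\<close> and \<open>p\<close>, show that the choice does not matter.\<close>

lemma ex_potential:
  fixes g :: "'a \<times> 'a \<Rightarrow> complex"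
  assumes con: "weakly_connected G"
    and inv: "\<And>a b. (a, b) \<in> parcs (mk_symmetric G) \<Longrightarrow> g (a, b) * g (b, a) = 1"
    and cyc: "\<And>C. ucycle G C \<Longrightarrow> prod_list (map g C) = 1"
    and nrm: "\<And>a b. (a, b) \<in> parcs (mk_symmetric G) \<Longrightarrow> cmod (g (a, b)) = 1"
  obtains \<phi> where "\<And>v. v \<in> verts G \<Longrightarrow> cmod (\<phi> v) = 1"
    "\<And>u p v. uwalk G u p v \<Longrightarrow> \<phi> v = \<phi> u * prod_list (map g p)"
proof -
  obtain r where r: "r \<in> verts G" using con weakly_connected_iff by blast
  define W where "W v = (SOME p. uwalk G r p v)" for v
  define \<phi> where "\<phi> v = prod_list (map g (W v))" for v
  have W: "uwalk G r (W v) v" if "v \<in> verts G" for v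
    unfolding W_def using weakly_connected_uwalk[OF con r that] by (metis someI_ex)
  have nw: "cmod (prod_list (map g p)) = 1" if "uwalk G u p v" for u p v
    using that by (induction p arbitrary: u) (auto simp: uwalk_Cons norm_mult nrm)
  show ?thesis
  proof (rule that[of \<phi>])
    show "cmod (\<phi> v) = 1" if "v \<in> verts G" for v using nw W[OF that] by (simp add: \<phi>_def)
    fix u p v assume p: "uwalk G u p v"
    then have uv: "u \<in> verts G" "v \<in> verts G" using uwalk_in_verts by auto
    obtain s where s: "uwalk G v s r" using weakly_connected_uwalk[OF con uv(2) r] by blast
    have "prod_list (map g (W v @ s)) = 1"
      by (rule prod_closed_uwalk[OF inv cyc]) (use W[OF uv(2)] s uwalk_append in blast)+
    moreover have "prod_list (map g (W u @ p @ s)) = 1"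
      by (rule prod_closed_uwalk[OF inv cyc]) (use W[OF uv(1)] p s uwalk_append in blast)+
    ultimately have "(\<phi> v - \<phi> u * prod_list (map g p)) * prod_list (map g s) = 0"
      by (simp add: \<phi>_def algebra_simps)
    moreover have "prod_list (map g s) \<noteq> 0" using nw[OF s] by (metis norm_zero zero_neq_one)
    ultimately show "\<phi> v = \<phi> u * prod_list (map g p)" by simp
  qed
qed

text \<open>The constant -1 has product 1 along all cycles, as a tree has none. This lets the
  distance in the exponent be replaced by the length of the tree path.\<close>

lemma tree_uwalk_parity:
  assumes tree: "oriented_tree G" and p: "uwalk G u p v" and q: "uwalk G v q u"
  shows "(- 1 :: complex) ^ length p = (- 1) ^ length q"
proof -
  have "prod_list (map (\<lambda>_. - 1) (p @ q)) = (1 :: complex)"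
    by (rule prod_closed_uwalk[where u = u]) (use tree p q uwalk_append in \<open>auto simp: oriented_tree_def\<close>)
  then have "(- 1 :: complex) ^ (length p + length q) = 1"
    by (simp add: map_replicate_const)
  then show ?thesis by (simp add: minus_one_power_iff split: if_splits)
qed

end

section \<open>The Moore--Penrose inverse of a gauged incidence matrix\<close>

text \<open>A maximal independent set of columns spans all columns, so together with
  \<open>z\<close> it is a basis of the whole space.\<close>

lemma (in vec_space) rank_eq_pred:
  assumes A: "A \<in> carrier_mat n nc" and z: "z \<in> carrier_vec n" "z \<notin> span (set (cols A))"
    and gen: "carrier_vec n \<subseteq> span (insert z (set (cols A)))"
  shows "rank A = n - 1"
proof -
  let ?C = "set (cols A)"
  have C: "?C \<subseteq> carrier_vec n" using A cols_dim by blast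
  obtain S where S: "maximal S (\<lambda>T. T \<subseteq> ?C \<and> lin_indpt T)"
    using maximal_exists_superset[of ?C "\<lambda>T. T \<subseteq> ?C \<and> lin_indpt T" "{}"]
    by (metis List.finite_set empty_subsetI finite_lin_indpt2 finite.emptyI empty_iff)
  then have SC: "S \<subseteq> ?C" and li: "lin_indpt S"
    and max: "\<And>B. S \<subseteq> B \<Longrightarrow> B \<subseteq> ?C \<Longrightarrow> lin_indpt B \<Longrightarrow> B = S"
    by (auto simp: maximal_def)
  have Sc: "S \<subseteq> carrier_vec n" using SC C by blast
  have fin: "finite S" using SC finite_subset by blast
  have sub: "?C \<subseteq> span S"
  proof
    fix c assume c: "c \<in> ?C"
    show "c \<in> span S"
    proof (cases "c \<in> S")
      case True
      then show ?thesis using in_own_span[of S] Sc by auto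
    next
      case False
      then have "lin_dep (S \<union> {c})" using max[of "S \<union> {c}"] c SC by auto
      then show ?thesis using lin_dep_iff_in_span[OF _ li _ False] Sc c C by auto
    qed
  qed
  have zS: "z \<notin> span S" using z span_is_monotone[OF SC] by blast
  then have zn: "z \<notin> S" using in_own_span[of S] Sc by auto
  have "lin_indpt (S \<union> {z})" using lin_dep_iff_in_span[OF _ li _ zn] Sc z zS by auto
  moreover have "span (S \<union> {z}) = carrier_vec n"
  proof -
    have Sz: "S \<union> {z} \<subseteq> carrier_vec n" using Sc z by auto
    have "?C \<subseteq> span (S \<union> {z})" using sub span_is_monotone[OF Un_upper1] by (rule subset_trans)
    moreover have "S \<union> {z} \<subseteq> span (S \<union> {z})" by (rule in_own_span) (use Sz in simp)
    ultimately have "insert z ?C \<subseteq> span (S \<union> {z})" by simp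
    then have "carrier_vec n \<subseteq> span (S \<union> {z})" using gen span_subsetI[OF Sz] by blast
    then show ?thesis using span_is_subset2[OF Sz] by auto
  qed
  ultimately have "basis (S \<union> {z})" using Sc z unfolding basis_def by auto
  then have "n = card (S \<union> {z})" using dim_basis[of "S \<union> {z}"] fin dim_is_n by simp
  then have "n = card S + 1" using zn fin by simp
  then show ?thesis using rank_card_indpt[OF A S] by simp
qed

text \<open>Conjugation takes a principal root out of the principal half-plane only if the root is
  nonzero and purely imaginary, that is, if \<open>z\<close> is negative.\<close>

lemma csqrt_cnj:
  assumes "z \<notin> neg_reals"
  shows "csqrt (cnj z) = cnj (csqrt z)"
proof (rule csqrt_unique)
  show "(cnj (csqrt z))\<^sup>2 = cnj z" by (simp flip: complex_cnj_power)
  have "Im (csqrt z) = 0" if "Re (csqrt z) = 0"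
  proof (rule ccontr)
    assume i: "Im (csqrt z) \<noteq> 0"
    have "csqrt z = \<i> * of_real (Im (csqrt z))" using that by (simp add: complex_eq_iff)
    then have "(csqrt z)\<^sup>2 = of_real (- (Im (csqrt z))\<^sup>2)"
      by (metis i_squared mult_minus_left mult_1 of_real_minus of_real_power power_mult_distrib power2_i)
    then have "z = of_real (- (Im (csqrt z))\<^sup>2)" by simp
    moreover have "- (Im (csqrt z))\<^sup>2 < 0" using i by simp
    ultimately show False using assms unfolding neg_reals_def by blast
  qed
  then show "0 < Re (cnj (csqrt z)) \<or> Re (cnj (csqrt z)) = 0 \<and> 0 \<le> Im (cnj (csqrt z))"
    using csqrt_principal[of z] by auto
qed

lemma index_mult_mat_sum:
  assumes "A \<in> carrier_mat n k" "B \<in> carrier_mat k m" "i < n" "j < m"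
  shows "(A * B) $$ (i, j) = (\<Sum>l<k. A $$ (i, l) * B $$ (l, j))"
  using assms by (simp add: scalar_prod_def atLeast0LessThan)

lemma index_mult_mat_vec_sum:
  assumes "A \<in> carrier_mat n k" "v \<in> carrier_vec k" "i < n"
  shows "(A *\<^sub>v v) $ i = (\<Sum>l<k. A $$ (i, l) * v $ l)"
  using assms by (simp add: scalar_prod_def atLeast0LessThan)

lemma mat_adjoint_index_cnj:
  fixes A :: "complex mat"
  assumes "A \<in> carrier_mat n m" "i < m" "j < n"
  shows "mat_adjoint A $$ (i, j) = cnj (A $$ (j, i))"
  using assms by (simp add: mat_adjoint_index)

text \<open>The locale serves for the whole graph and, with the same \<open>\<phi>\<close>, for each
  spanning tree, whose arc labels may have gaps.\<close>

locale gauged_graph = oriented_graph G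
  for G :: "(nat, nat) pre_digraph" +
  fixes n :: nat and w :: "nat \<Rightarrow> nat \<Rightarrow> complex" and \<phi> :: "nat \<Rightarrow> complex"
  assumes verts_eq: "verts G = {..<n}"
    and weight: "e \<in> arcs G \<Longrightarrow> arc_weight G w e \<noteq> 0" "e \<in> arcs G \<Longrightarrow> arc_weight G w e \<notin> neg_reals"
    and norm_gauge: "v < n \<Longrightarrow> cmod (\<phi> v) = 1"
    and gauge: "e \<in> arcs G \<Longrightarrow>
      \<phi> (head G e) = \<phi> (tail G e) * (- arc_weight G w e / cmod (arc_weight G w e))"
    and n_pos: "0 < n"
begin

text \<open>The diagonal entry of \<open>S\<close> at \<open>e\<close>. Computed from the head it is
  the same number up to sign, by \<open>scale_head\<close>.\<close>

definition scale :: "nat \<Rightarrow> complex" where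
  "scale e = \<phi> (tail G e) * csqrt (arc_weight G w e)"

abbreviation nth_arc :: "nat \<Rightarrow> nat" where
  "nth_arc k \<equiv> sorted_list_of_set (arcs G) ! k"

abbreviation N :: "complex mat" where
  "N \<equiv> signless_incidence G w"

text \<open>The matrix \<open>S\<^sup>-\<^sup>1 F D\<close>, with rows in increasing order of the
  arc labels.\<close>

definition gauged_mat :: "(nat \<Rightarrow> nat \<Rightarrow> complex) \<Rightarrow> complex mat" where
  "gauged_mat F = mat (card (arcs G)) n (\<lambda>(k, j). \<phi> j * F (nth_arc k) j / scale (nth_arc k))"

lemma ends_less: "e \<in> arcs G \<Longrightarrow> tail G e < n" "e \<in> arcs G \<Longrightarrow> head G e < n"
  using verts_eq tail_in_verts head_in_verts by blast+

lemma gauge_cnj: "v < n \<Longrightarrow> cnj (\<phi> v) * \<phi> v = 1" "v < n \<Longrightarrow> \<phi> v * cnj (\<phi> v) = 1"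
  using norm_gauge by (auto simp: complex_norm_square[symmetric] mult.commute)

lemma gauge_nonzero: "v < n \<Longrightarrow> \<phi> v \<noteq> 0"
  using norm_gauge by force

lemma csqrt_cnj_csqrt: "csqrt z * cnj (csqrt z) = cmod z"
  by (metis complex_norm_square norm_power power2_csqrt)

lemma scale_nonzero: "e \<in> arcs G \<Longrightarrow> scale e \<noteq> 0"
  using weight gauge_nonzero ends_less by (auto simp: scale_def)

lemma scale_cnj: "e \<in> arcs G \<Longrightarrow> scale e * cnj (scale e) = cmod (arc_weight G w e)"
proof -
  assume "e \<in> arcs G"
  then have "(\<phi> (tail G e) * cnj (\<phi> (tail G e))) * (csqrt (arc_weight G w e) * cnj (csqrt (arc_weight G w e)))
      = cmod (arc_weight G w e)"
    using gauge_cnj(2) ends_less by (simp only: csqrt_cnj_csqrt) simp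
  then show ?thesis by (simp add: scale_def ac_simps)
qed

text \<open>The phase of the weight \<open>a\<close> turns the conjugate of \<open>csqrt a\<close>
  into \<open>csqrt a\<close>, and off the negative reals that conjugate is
  \<open>csqrt (cnj a)\<close>. The minus sign of the gauge becomes the sign of the head in
  \<open>B\<close>.\<close>

lemma scale_head: "e \<in> arcs G \<Longrightarrow> scale e = - \<phi> (head G e) * csqrt (cnj (arc_weight G w e))"
proof -
  assume e: "e \<in> arcs G"
  let ?a = "arc_weight G w e"
  have "?a / cmod ?a * cnj (csqrt ?a) = csqrt ?a"
  proof -
    have "?a * cnj (csqrt ?a) = csqrt ?a * (csqrt ?a * cnj (csqrt ?a))"
      by (simp add: power2_eq_square[symmetric] flip: mult.assoc)
    also have "\<dots> = csqrt ?a * cmod ?a" by (simp only: csqrt_cnj_csqrt)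
    finally show ?thesis using weight(1)[OF e] by simp
  qed
  then have "\<phi> (tail G e) * csqrt ?a = \<phi> (tail G e) * (?a / cmod ?a * cnj (csqrt ?a))" by simp
  then show ?thesis
    by (simp add: scale_def gauge[OF e] csqrt_cnj[OF weight(2)[OF e]])
qed

lemma nth_arc: "k < card (arcs G) \<Longrightarrow> nth_arc k \<in> arcs G"
  using nth_mem[of k "sorted_list_of_set (arcs G)"] by simp

lemma sum_nth_arc: "(\<Sum>k<card (arcs G). f (nth_arc k)) = (\<Sum>e\<in>arcs G. f e)"
  by (rule sum.reindex_bij_betw) (auto intro!: bij_betw_nth)

lemma N_carrier: "N \<in> carrier_mat n (card (arcs G))"
  by (simp add: signless_incidence_def verts_eq)

text \<open>The factorization \<open>N = D\<^sup>* B S\<close> entry by entry; the row of the head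
  relies on \<open>scale_head\<close>.\<close>

lemma N_index:
  assumes i: "i < n" and k: "k < card (arcs G)"
  shows "N $$ (i, k) = cnj (\<phi> i) * incidence i (nth_arc k) * scale (nth_arc k)"
proof -
  let ?e = "nth_arc k"
  have e: "?e \<in> arcs G" using nth_arc k .
  have h: "csqrt (cnj (arc_weight G w ?e)) = cnj (\<phi> (head G ?e)) * - scale ?e"
    using gauge_cnj(1)[OF ends_less(2)[OF e]] scale_head[OF e] by (simp flip: mult.assoc)
  have t: "csqrt (arc_weight G w ?e) = cnj (\<phi> (tail G ?e)) * scale ?e"
    using gauge_cnj(1)[OF ends_less(1)[OF e]] by (simp add: scale_def flip: mult.assoc)
  have "N $$ (i, k) = (if i = tail G ?e then csqrt (arc_weight G w ?e)
       else if i = head G ?e then csqrt (cnj (arc_weight G w ?e)) else 0)"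
    using i k by (simp add: signless_incidence_def verts_eq Let_def)
  also have "\<dots> = cnj (\<phi> i) * incidence i ?e * scale ?e"
    using no_loops[OF e] by (auto simp: incidence_def h t)
  finally show ?thesis .
qed

lemma sum_incidence:
  assumes "e \<in> arcs G"
  shows "(\<Sum>j<n. incidence j e * f j) = f (tail G e) - f (head G e)"
proof -
  have "(\<Sum>j<n. of_bool (j = v) * f j) = f v" if "v < n" for v
    using that by (simp add: of_bool_def if_distrib[of "\<lambda>x. x * _"] cong: if_cong)
  then show ?thesis
    using ends_less[OF assms] by (simp add: incidence_def left_diff_distrib sum_subtractf)
qed

text \<open>The assumptions on the real matrix \<open>F\<close> are \<open>B F = I - J/n\<close>,
  \<open>F J = 0\<close> and the symmetry of \<open>(F B)\<^sub>e\<^sub>f |w\<^sub>f|\<close>. They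
  stay abstract in order to cover both the mean flow of the graph and the flow of a single
  tree.\<close>

context
  fixes F :: "nat \<Rightarrow> nat \<Rightarrow> complex"
  assumes flow_real: "\<And>e j. cnj (F e j) = F e j"
    and flow: "\<And>i j. i < n \<Longrightarrow> j < n \<Longrightarrow>
      (\<Sum>e\<in>arcs G. incidence i e * F e j) = of_bool (i = j) - 1 / of_nat n"
    and flow_sum: "\<And>e. e \<in> arcs G \<Longrightarrow> (\<Sum>j<n. F e j) = 0"
    and flow_sym: "\<And>e e'. e \<in> arcs G \<Longrightarrow> e' \<in> arcs G \<Longrightarrow>
      cmod (arc_weight G w e') * (F e (tail G e') - F e (head G e')) =
      cmod (arc_weight G w e) * (F e' (tail G e) - F e' (head G e))"
begin

lemma gauged_mat_carrier: "gauged_mat F \<in> carrier_mat (card (arcs G)) n"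
  by (simp add: gauged_mat_def)

lemma gauged_mat_index:
  "k < card (arcs G) \<Longrightarrow> j < n \<Longrightarrow> gauged_mat F $$ (k, j) = \<phi> j * F (nth_arc k) j / scale (nth_arc k)"
  by (simp add: gauged_mat_def)

text \<open>The scaling cancels against its inverse, which leaves \<open>I - J/n\<close> conjugated
  by \<open>D\<close>.\<close>

lemma NX_index:
  assumes "i < n" "j < n"
  shows "(N * gauged_mat F) $$ (i, j) = cnj (\<phi> i) * \<phi> j * (of_bool (i = j) - 1 / of_nat n)"
proof -
  have "(N * gauged_mat F) $$ (i, j) = (\<Sum>k<card (arcs G). N $$ (i, k) * gauged_mat F $$ (k, j))"
    by (rule index_mult_mat_sum) (use assms N_carrier gauged_mat_carrier in auto)
  also have "\<dots> = (\<Sum>k<card (arcs G). cnj (\<phi> i) * \<phi> j * (incidence i (nth_arc k) * F (nth_arc k) j))"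
    using assms scale_nonzero nth_arc by (intro sum.cong refl) (simp add: N_index gauged_mat_index)
  also have "\<dots> = cnj (\<phi> i) * \<phi> j * (\<Sum>e\<in>arcs G. incidence i e * F e j)"
    by (simp only: sum_nth_arc[of "\<lambda>e. cnj (\<phi> i) * \<phi> j * (incidence i e * F e j)"] sum_distrib_left)
  finally show ?thesis by (simp add: flow assms)
qed

lemma XN_index:
  assumes k: "k < card (arcs G)" and l: "l < card (arcs G)"
  shows "(gauged_mat F * N) $$ (k, l) = scale (nth_arc l) / scale (nth_arc k) *
    (F (nth_arc k) (tail G (nth_arc l)) - F (nth_arc k) (head G (nth_arc l)))"
proof -
  let ?e = "nth_arc k" and ?f = "nth_arc l"
  have "(gauged_mat F * N) $$ (k, l) = (\<Sum>j<n. gauged_mat F $$ (k, j) * N $$ (j, l))"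
    by (rule index_mult_mat_sum) (use assms N_carrier gauged_mat_carrier in auto)
  also have "\<dots> = (\<Sum>j<n. scale ?f / scale ?e * (incidence j ?f * F ?e j))"
  proof (rule sum.cong)
    fix j assume "j \<in> {..<n}"
    then have j: "j < n" by simp
    have "gauged_mat F $$ (k, j) * N $$ (j, l) = (\<phi> j * cnj (\<phi> j)) * (scale ?f / scale ?e * (incidence j ?f * F ?e j))"
      using j k l by (simp add: N_index gauged_mat_index)
    then show "gauged_mat F $$ (k, j) * N $$ (j, l) = scale ?f / scale ?e * (incidence j ?f * F ?e j)"
      using gauge_cnj j by simp
  qed simp
  also have "\<dots> = scale ?f / scale ?e * (F ?e (tail G ?f) - F ?e (head G ?f))"
    unfolding sum_distrib_left[symmetric] sum_incidence[OF nth_arc[OF l]] ..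
  finally show ?thesis .
qed

text \<open>The first equation holds because the columns of \<open>B\<close> sum to 0, the second
  because the rows of \<open>F\<close> do. The product \<open>N X\<close> is Hermitian as a unitary
  conjugate of \<open>I - J/n\<close>, and \<open>X N\<close> by the symmetry
  \<open>flow_sym\<close>.\<close>

lemma is_moore_penrose_gauged_mat: "is_moore_penrose N (gauged_mat F)"
proof -
  let ?X = "gauged_mat F" and ?m = "card (arcs G)"
  note cN = N_carrier and cX = gauged_mat_carrier
  have cNX: "N * ?X \<in> carrier_mat n n" and cXN: "?X * N \<in> carrier_mat ?m ?m"
    using cN cX by auto
  have 1: "N * ?X * N = N"
  proof (rule eq_matI)
    fix i k assume "i < dim_row N" "k < dim_col N"
    then have i: "i < n" and k: "k < ?m" using cN by auto
    let ?e = "nth_arc k"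
    have "(N * ?X * N) $$ (i, k) = (\<Sum>j<n. (N * ?X) $$ (i, j) * N $$ (j, k))"
      by (rule index_mult_mat_sum[OF cNX cN i k])
    also have "\<dots> = (\<Sum>j<n. cnj (\<phi> i) * scale ?e * (incidence j ?e * (of_bool (i = j) - 1 / of_nat n)))"
    proof (rule sum.cong)
      fix j assume "j \<in> {..<n}"
      then have j: "j < n" by simp
      have "(N * ?X) $$ (i, j) * N $$ (j, k) =
          (\<phi> j * cnj (\<phi> j)) * (cnj (\<phi> i) * scale ?e * (incidence j ?e * (of_bool (i = j) - 1 / of_nat n)))"
        by (simp only: NX_index[OF i j] N_index[OF j k] ac_simps)
      then show "(N * ?X) $$ (i, j) * N $$ (j, k) =
          cnj (\<phi> i) * scale ?e * (incidence j ?e * (of_bool (i = j) - 1 / of_nat n))"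
        using gauge_cnj j by simp
    qed simp
    also have "\<dots> = cnj (\<phi> i) * scale ?e * incidence i ?e"
      unfolding sum_distrib_left[symmetric] sum_incidence[OF nth_arc[OF k]] by (simp add: incidence_def)
    also have "\<dots> = N $$ (i, k)" by (simp add: N_index i k)
    finally show "(N * ?X * N) $$ (i, k) = N $$ (i, k)" .
  qed (use cN cX in auto)
  have 2: "?X * N * ?X = ?X"
  proof (rule eq_matI)
    fix k i assume "k < dim_row ?X" "i < dim_col ?X"
    then have i: "i < n" and k: "k < ?m" using cX by auto
    let ?e = "nth_arc k"
    have "(?X * N * ?X) $$ (k, i) = (?X * (N * ?X)) $$ (k, i)"
      using assoc_mult_mat[OF cX cN cX] by simp
    also have "\<dots> = (\<Sum>j<n. ?X $$ (k, j) * (N * ?X) $$ (j, i))"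
      by (rule index_mult_mat_sum[OF cX cNX k i])
    also have "\<dots> = (\<Sum>j<n. \<phi> i / scale ?e * (of_bool (j = i) * F ?e j - F ?e j / of_nat n))"
    proof (rule sum.cong)
      fix j assume "j \<in> {..<n}"
      then have j: "j < n" by simp
      have "?X $$ (k, j) * (N * ?X) $$ (j, i) =
          (\<phi> j * cnj (\<phi> j)) * (\<phi> i / scale ?e * (of_bool (j = i) * F ?e j - F ?e j / of_nat n))"
        by (simp add: NX_index[OF j i] gauged_mat_index[OF k j] algebra_simps)
      then show "?X $$ (k, j) * (N * ?X) $$ (j, i) =
          \<phi> i / scale ?e * (of_bool (j = i) * F ?e j - F ?e j / of_nat n)"
        using gauge_cnj j by simp
    qed simp
    also have "\<dots> = \<phi> i / scale ?e * F ?e i"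
    proof -
      have "(\<Sum>j<n. F ?e j / of_nat n) = 0"
        using flow_sum[OF nth_arc[OF k]] by (simp flip: sum_divide_distrib)
      moreover have "(\<Sum>j<n. of_bool (j = i) * F ?e j) = F ?e i"
        using i by (simp add: of_bool_def if_distrib[of "\<lambda>x. x * _"] cong: if_cong)
      ultimately show ?thesis by (simp only: sum_distrib_left[symmetric] sum_subtractf) simp
    qed
    also have "\<dots> = ?X $$ (k, i)" by (simp add: gauged_mat_index i k)
    finally show "(?X * N * ?X) $$ (k, i) = ?X $$ (k, i)" .
  qed (use cN cX in auto)
  have 3: "mat_adjoint (N * ?X) = N * ?X"
  proof (rule eq_matI)
    fix i j assume "i < dim_row (N * ?X)" "j < dim_col (N * ?X)"
    then have ij: "i < n" "j < n" using cNX by auto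
    then have "mat_adjoint (N * ?X) $$ (i, j) = cnj ((N * ?X) $$ (j, i))"
      by (rule mat_adjoint_index_cnj[OF cNX])
    also have "\<dots> = (N * ?X) $$ (i, j)"
      unfolding NX_index[OF ij] NX_index[OF ij(2,1)] by (cases "i = j") auto
    finally show "mat_adjoint (N * ?X) $$ (i, j) = (N * ?X) $$ (i, j)" .
  qed (use mat_adjoint_carrier[OF cNX] cNX in auto)
  have 4: "mat_adjoint (?X * N) = ?X * N"
  proof (rule eq_matI)
    fix k l assume "k < dim_row (?X * N)" "l < dim_col (?X * N)"
    then have kl: "k < ?m" "l < ?m" using cXN by auto
    let ?e = "nth_arc k" and ?f = "nth_arc l"
    have e: "?e \<in> arcs G" and f: "?f \<in> arcs G" using nth_arc kl by auto
    let ?D = "\<lambda>e f. F e (tail G f) - F e (head G f)"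
    have "mat_adjoint (?X * N) $$ (k, l) = cnj ((?X * N) $$ (l, k))"
      by (rule mat_adjoint_index_cnj[OF cXN kl])
    also have "\<dots> = cnj (scale ?e) / cnj (scale ?f) * ?D ?f ?e"
      unfolding XN_index[OF kl(2,1)] by (simp add: flow_real)
    \<comment> \<open>As \<open>scale e * cnj (scale e)\<close> is the modulus of the weight, each
      conjugated factor becomes a modulus over a scale, and \<open>flow_sym\<close> interchanges the
      two arcs.\<close>
    also have "\<dots> = scale ?f / scale ?e * ?D ?e ?f"
    proof -
      let ?c = "\<lambda>e. complex_of_real (cmod (arc_weight G w e))"
      have "cnj (scale ?e) = ?c ?e / scale ?e" "cnj (scale ?f) = ?c ?f / scale ?f"
        using scale_cnj[OF e] scale_cnj[OF f] scale_nonzero e f by (simp_all add: field_simps)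
      then have "cnj (scale ?e) / cnj (scale ?f) * ?D ?f ?e = scale ?f / scale ?e * (?c ?e * ?D ?f ?e / ?c ?f)"
        by simp
      also have "?c ?e * ?D ?f ?e / ?c ?f = ?D ?e ?f"
        using flow_sym[OF e f] weight(1)[OF f] by (simp add: field_simps)
      finally show ?thesis .
    qed
    also have "\<dots> = (?X * N) $$ (k, l)" using XN_index[OF kl] by simp
    finally show "mat_adjoint (?X * N) $$ (k, l) = (?X * N) $$ (k, l)" .
  qed (use mat_adjoint_carrier[OF cXN] cXN in auto)
  show ?thesis
    unfolding is_moore_penrose_def using 1 2 3 4 cN cX by auto
qed

text \<open>The functional \<open>\<alpha>\<close> vanishes on the column space, since the columns
  of \<open>B\<close> sum to 0, but not at \<open>z\<close>. Conversely \<open>N X\<close> is the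
  identity minus the orthogonal projection onto the line of \<open>z\<close>, so the columns and
  \<open>z\<close> span everything.\<close>

lemma rank_N: "vec_space.rank n N = n - 1"
proof -
  interpret vec_space "TYPE(complex)" n .
  define z where "z = vec n (\<lambda>i. cnj (\<phi> i))"
  define \<alpha> :: "complex vec \<Rightarrow> complex" where "\<alpha> y = (\<Sum>i<n. \<phi> i * y $ i)" for y
  have z: "z \<in> carrier_vec n" by (simp add: z_def)
  note cN = N_carrier and cX = gauged_mat_carrier
  let ?C = "set (cols N)"
  have C: "?C \<subseteq> carrier_vec n" using cN cols_dim by blast
  have colsp: "span ?C = {y \<in> carrier_vec n. \<exists>x\<in>carrier_vec (card (arcs G)). N *\<^sub>v x = y}"
    using col_space_eq[OF cN] cN unfolding col_space_def by auto
  show ?thesis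
  proof (rule rank_eq_pred[OF cN z])
    have "\<alpha> (N *\<^sub>v x) = 0" if x: "x \<in> carrier_vec (card (arcs G))" for x
    proof -
      have "\<alpha> (N *\<^sub>v x) = (\<Sum>i<n. \<Sum>k<card (arcs G). \<phi> i * (N $$ (i, k) * x $ k))"
        using cN x by (simp add: \<alpha>_def scalar_prod_def atLeast0LessThan sum_distrib_left)
      also have "\<dots> = (\<Sum>k<card (arcs G). \<Sum>i<n. \<phi> i * (N $$ (i, k) * x $ k))" by (rule sum.swap)
      also have "\<dots> = (\<Sum>k<card (arcs G). \<Sum>i<n. incidence i (nth_arc k) * (scale (nth_arc k) * x $ k))"
      proof (intro sum.cong refl)
        fix i k assume "i \<in> {..<n}" "k \<in> {..<card (arcs G)}"
        then have i: "i < n" and k: "k < card (arcs G)" by auto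
        have "\<phi> i * (N $$ (i, k) * x $ k) =
            (\<phi> i * cnj (\<phi> i)) * (incidence i (nth_arc k) * (scale (nth_arc k) * x $ k))"
          by (simp only: N_index[OF i k] ac_simps)
        then show "\<phi> i * (N $$ (i, k) * x $ k) = incidence i (nth_arc k) * (scale (nth_arc k) * x $ k)"
          using gauge_cnj i by simp
      qed
      also have "\<dots> = 0" by (rule sum.neutral) (use sum_incidence[OF nth_arc] in auto)
      finally show ?thesis .
    qed
    moreover have "\<alpha> z = of_nat n" using gauge_cnj by (simp add: \<alpha>_def z_def)
    ultimately show "z \<notin> span ?C" using n_pos unfolding colsp by auto
    show "carrier_vec n \<subseteq> span (insert z ?C)"
    proof
      fix y :: "complex vec" assume y: "y \<in> carrier_vec n"
      have Cz: "insert z ?C \<subseteq> carrier_vec n" using C z by auto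
      \<comment> \<open>Because \<open>\<alpha> z = n\<close>, this is the coefficient of the
        component of \<open>y\<close> along \<open>z\<close>, which \<open>N X\<close>
        removes.\<close>
      let ?c = "\<alpha> y / of_nat n"
      have "gauged_mat F *\<^sub>v y \<in> carrier_vec (card (arcs G))" using cX y by auto
      then have "N *\<^sub>v (gauged_mat F *\<^sub>v y) \<in> span ?C"
        unfolding colsp using mult_mat_vec_carrier[OF cN] by blast
      then have "N *\<^sub>v (gauged_mat F *\<^sub>v y) \<in> span (insert z ?C)"
        by (rule subsetD[OF span_is_monotone[OF subset_insertI]])
      moreover have "?c \<cdot>\<^sub>v z \<in> span (insert z ?C)"
        by (rule smult_in_span[OF Cz]) (rule span_mem, use Cz in auto)
      ultimately have "N *\<^sub>v (gauged_mat F *\<^sub>v y) + ?c \<cdot>\<^sub>v z \<in> span (insert z ?C)"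
        using span_add1[OF Cz] by simp
      also have "N *\<^sub>v (gauged_mat F *\<^sub>v y) + ?c \<cdot>\<^sub>v z = y"
      proof (rule eq_vecI)
        fix i assume "i < dim_vec y"
        then have i: "i < n" using y by simp
        have "(N *\<^sub>v (gauged_mat F *\<^sub>v y)) $ i = ((N * gauged_mat F) *\<^sub>v y) $ i"
          using assoc_mult_mat_vec[OF cN cX y] by simp
        also have "\<dots> = (\<Sum>j<n. (N * gauged_mat F) $$ (i, j) * y $ j)"
          by (rule index_mult_mat_vec_sum) (use cN cX y i in auto)
        also have "\<dots> = (\<Sum>j<n. of_bool (i = j) * y $ i - cnj (\<phi> i) * (\<phi> j * y $ j) / of_nat n)"
        proof (intro sum.cong refl)
          fix j assume "j \<in> {..<n}"
          then have j: "j < n" by simp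
          have "cnj (\<phi> i) * \<phi> j * of_bool (i = j) * y $ j = of_bool (i = j) * y $ i"
            using gauge_cnj i by auto
          then show "(N * gauged_mat F) $$ (i, j) * y $ j =
              of_bool (i = j) * y $ i - cnj (\<phi> i) * (\<phi> j * y $ j) / of_nat n"
            unfolding NX_index[OF i j] by (simp add: algebra_simps)
        qed
        also have "\<dots> = y $ i - cnj (\<phi> i) * \<alpha> y / of_nat n"
          using i by (simp add: sum_subtractf \<alpha>_def sum_distrib_left flip: sum_divide_distrib sum_distrib_right)
        finally show "(N *\<^sub>v (gauged_mat F *\<^sub>v y) + ?c \<cdot>\<^sub>v z) $ i = y $ i"
          using i cN by (simp add: z_def)
      qed (use y cN z in auto)
      finally show "y \<in> span (insert z ?C)" .
    qed
  qed
qed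

end

end

section \<open>Oriented spanning trees\<close>

text \<open>Exactly the positions before that of \<open>e\<close> hold smaller elements. This
  locates the row of an arc in the inverse.\<close>

lemma nth_sorted_list_of_set_card:
  fixes A :: "nat set"
  assumes "finite A" "e \<in> A"
  shows "sorted_list_of_set A ! card {a \<in> A. a < e} = e" "card {a \<in> A. a < e} < card A"
proof -
  let ?L = "sorted_list_of_set A"
  obtain k where k: "k < card A" "?L ! k = e"
    using assms by (metis in_set_conv_nth sorted_list_of_set.length_sorted_key_list_of_set set_sorted_list_of_set)
  have mono: "?L ! i < ?L ! j \<longleftrightarrow> i < j" if "i < card A" "j < card A" for i j
    using that strict_sorted_list_of_set[of A]
    by (metis linorder_neqE_nat order_less_asym sorted_list_of_set.length_sorted_key_list_of_set sorted_wrt_nth_less)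
  have "{a \<in> A. a < e} = (!) ?L ` {..<k}"
  proof (intro equalityI subsetI)
    fix a assume a: "a \<in> {a \<in> A. a < e}"
    then obtain l where "l < card A" "?L ! l = a"
      using assms by (metis (no_types, lifting) in_set_conv_nth mem_Collect_eq
        sorted_list_of_set.length_sorted_key_list_of_set set_sorted_list_of_set)
    then show "a \<in> (!) ?L ` {..<k}" using a k mono[of l k] by auto
  next
    fix a assume "a \<in> (!) ?L ` {..<k}"
    then obtain l where l: "l < k" "a = ?L ! l" by auto
    then have "a \<in> set ?L" using k by (auto intro!: nth_mem)
    then show "a \<in> {a \<in> A. a < e}" using l k mono[of l k] assms by auto
  qed
  moreover have "inj_on ((!) ?L) {..<k}"
    using k by (intro inj_on_subset[OF inj_on_nth[of ?L "{..<card A}"]]) auto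
  ultimately have "card {a \<in> A. a < e} = k" by (simp add: card_image)
  then show "sorted_list_of_set A ! card {a \<in> A. a < e} = e" "card {a \<in> A. a < e} < card A"
    using k by auto
qed

text \<open>The cut notions refer to the vertices and to the ends of arcs but never to
  \<open>arcs\<close>, so a spanning subgraph shares them with the whole graph.\<close>

lemma (in pre_digraph) cuts_cong:
  assumes "verts T = verts G" "tail T = tail G" "head T = head G"
  shows "pre_digraph.crosses T = crosses" "pre_digraph.cut_connected T = cut_connected"
    "pre_digraph.cut_tree T = cut_tree" "pre_digraph.tail_side T = tail_side"
    "pre_digraph.tree_flow T = tree_flow"
proof -
  show c: "pre_digraph.crosses T = crosses"
    using assms by (simp add: fun_eq_iff pre_digraph.crosses_def)
  show cc: "pre_digraph.cut_connected T = cut_connected"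
    using assms by (simp add: fun_eq_iff pre_digraph.cut_connected_def c)
  show "pre_digraph.cut_tree T = cut_tree"
    using assms by (simp add: fun_eq_iff pre_digraph.cut_tree_def c cc)
  show s: "pre_digraph.tail_side T = tail_side"
    using assms by (simp add: fun_eq_iff pre_digraph.tail_side_def pre_digraph.is_tail_side_def c)
  show "pre_digraph.tree_flow T = tree_flow"
    using assms by (simp add: fun_eq_iff pre_digraph.tree_flow_def s)
qed

context oriented_graph
begin

lemma spanning_facts:
  assumes "spanning T G"
  shows "verts T = verts G" "tail T = tail G" "head T = head G" "arcs T \<subseteq> arcs G" "oriented_graph T"
proof -
  show vth: "verts T = verts G" "tail T = tail G" "head T = head G" "arcs T \<subseteq> arcs G"
    using assms by (auto simp: spanning_def subgraph_def compatible_def)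
  interpret T: digraph T
    using assms digraph_subgraph by (auto simp: spanning_def)
  have "arcs_ends T \<subseteq> arcs_ends G" using vth by (auto simp: arcs_ends_conv)
  then show "oriented_graph T" using no_opposite_arcs by unfold_locales blast
qed

text \<open>A spanning subgraph is determined by its arcs. Sums over oriented spanning trees thus
  become sums over \<open>trees\<close>.\<close>

lemma bij_betw_arcs_oriented_spanning_trees:
  assumes ne: "verts G \<noteq> {}"
  shows "bij_betw arcs (oriented_spanning_trees G) trees"
proof (rule bij_betw_byWitness[where f' = "\<lambda>A. \<lparr>verts = verts G, arcs = A, tail = tail G, head = head G\<rparr>"])
  show "\<forall>T\<in>oriented_spanning_trees G. \<lparr>verts = verts G, arcs = arcs T, tail = tail G, head = head G\<rparr> = T"
    using spanning_facts by (auto simp: oriented_spanning_trees_def)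
  show "\<forall>A\<in>trees. arcs \<lparr>verts = verts G, arcs = A, tail = tail G, head = head G\<rparr> = A" by simp
  show "arcs ` oriented_spanning_trees G \<subseteq> trees"
  proof
    fix A assume "A \<in> arcs ` oriented_spanning_trees G"
    then obtain T where T: "A = arcs T" "spanning T G" "oriented_tree T"
      by (auto simp: oriented_spanning_trees_def)
    note sp = spanning_facts[OF T(2)]
    show "A \<in> trees"
      using oriented_graph.oriented_tree_iff[OF sp(5)] T sp(4) cuts_cong(3)[OF sp(1-3)] by (simp add: trees_def)
  qed
  show "(\<lambda>A. \<lparr>verts = verts G, arcs = A, tail = tail G, head = head G\<rparr>) ` trees \<subseteq> oriented_spanning_trees G"
  proof
    fix T assume "T \<in> (\<lambda>A. \<lparr>verts = verts G, arcs = A, tail = tail G, head = head G\<rparr>) ` trees"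
    then obtain A where T: "T = \<lparr>verts = verts G, arcs = A, tail = tail G, head = head G\<rparr>"
      and A: "A \<subseteq> arcs G" "cut_tree A" by (auto simp: trees_def)
    have "wf_digraph T" using A(1) T by unfold_locales auto
    then have span: "spanning T G"
      using A T wf_digraph by (auto simp: spanning_def subgraph_def compatible_def)
    note sp = spanning_facts[OF span]
    show "T \<in> oriented_spanning_trees G"
      using oriented_graph.oriented_tree_iff[OF sp(5)] span A cuts_cong(3)[OF sp(1-3)] T ne
      by (simp add: oriented_spanning_trees_def)
  qed
qed

lemma uwalk_spanning:
  assumes sp: "spanning T G" and p: "uwalk T u p v"
  shows "uwalk G u p v"
proof -
  interpret T: oriented_graph T by (rule spanning_facts(5)[OF sp])
  have "parcs (mk_symmetric T) \<subseteq> parcs (mk_symmetric G)"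
    using spanning_facts(2-4)[OF sp] by (auto simp: mk_symmetric_def)
  then show ?thesis
    using p spanning_facts(1)[OF sp]
    by (induction p arbitrary: u) (auto simp: T.uwalk_Nil T.uwalk_Cons uwalk_Nil uwalk_Cons)
qed

section \<open>The gauge\<close>

lemma adj_weight_arc:
  assumes "e \<in> arcs G"
  shows "adj_weight G w (tail G e) (head G e) = arc_weight G w e"
    "adj_weight G w (head G e) (tail G e) = cnj (arc_weight G w e)"
  using in_arcs_imp_in_arcs_ends[OF assms] no_opposite_arcs
  by (auto simp: adj_weight_def arc_weight_def)

lemma walk_weight_phase:
  "prod_list (map (\<lambda>(i, j). - adj_weight G w i j / cmod (adj_weight G w i j)) p) =
     (- 1) ^ length p * (walk_weight G w p / cmod (walk_weight G w p))"
  by (induction p) (auto simp: walk_weight_def norm_mult)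

text \<open>The factor \<open>(- 1) ^ length p\<close> makes the phase -1 of an odd cycle and the
  phase 1 of an even cycle both equal to 1, so \<open>g\<close> has product 1 along every
  cycle.\<close>

lemma ex_gauge:
  assumes con: "weakly_connected G"
    and wt: "\<And>e. e \<in> arcs G \<Longrightarrow> arc_weight G w e \<noteq> 0"
    and odd_cycle: "\<And>C. ucycle G C \<Longrightarrow> odd (length C) \<Longrightarrow> walk_weight G w C \<in> neg_reals"
    and even_cycle: "\<And>C. ucycle G C \<Longrightarrow> even (length C) \<Longrightarrow> walk_weight G w C \<in> pos_reals"
  obtains \<phi> where "\<And>v. v \<in> verts G \<Longrightarrow> cmod (\<phi> v) = 1"
    "\<And>u p v. uwalk G u p v \<Longrightarrow>
      \<phi> v = \<phi> u * ((- 1) ^ length p * (walk_weight G w p / cmod (walk_weight G w p)))"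
proof -
  define g where "g = (\<lambda>(i, j). - adj_weight G w i j / cmod (adj_weight G w i j))"
  have edge: "adj_weight G w a b \<noteq> 0 \<and> adj_weight G w b a = cnj (adj_weight G w a b)"
    if "(a, b) \<in> parcs (mk_symmetric G)" for a b
    using that wt adj_weight_arc by (auto simp: parcs_mk_symmetric_iff)
  have inv: "g (a, b) * g (b, a) = 1" if "(a, b) \<in> parcs (mk_symmetric G)" for a b
    using edge[OF that] complex_norm_square[of "adj_weight G w a b"]
    by (simp add: g_def field_simps power2_eq_square)
  have closed: "prod_list (map g C) = 1" if cyc: "ucycle G C" for C
  proof (cases "even (length C)")
    case True
    then obtain r where "0 < r" "walk_weight G w C = complex_of_real r"
      using even_cycle[OF cyc] by (auto simp: pos_reals_def)
    then show ?thesis using True unfolding g_def walk_weight_phase by simp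
  next
    case False
    then obtain r where "r < 0" "walk_weight G w C = complex_of_real r"
      using odd_cycle[OF cyc] by (auto simp: neg_reals_def)
    then show ?thesis using False unfolding g_def walk_weight_phase by simp
  qed
  have unit: "cmod (g (a, b)) = 1" if "(a, b) \<in> parcs (mk_symmetric G)" for a b
    using edge[OF that] by (simp add: g_def norm_divide)
  obtain \<phi> where "\<And>v. v \<in> verts G \<Longrightarrow> cmod (\<phi> v) = 1"
    "\<And>u p v. uwalk G u p v \<Longrightarrow> \<phi> v = \<phi> u * prod_list (map g p)"
    by (rule ex_potential[OF con inv closed unit]) (assumption+, rule that)
  then show ?thesis unfolding g_def walk_weight_phase by (rule that)
qed

end

theorem theorem4p8:
  fixes G :: "(nat, nat) pre_digraph"
    and w :: "nat \<Rightarrow> nat \<Rightarrow> complex"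
    and n m :: nat
  assumes "oriented_graph G"
    and "weakly_connected G"
    and "n \<ge> 2" and "m \<ge> 1"
    and "verts G = {..<n}" and "arcs G = {..<m}"
    and "\<forall>e\<in>arcs G. arc_weight G w e \<noteq> 0 \<and> arc_weight G w e \<notin> neg_reals"
    and "\<exists>C. ucycle G C"
    and "\<forall>C. ucycle G C \<and> odd (length C) \<longrightarrow> walk_weight G w C \<in> neg_reals"
    and "\<forall>C. ucycle G C \<and> even (length C) \<longrightarrow> walk_weight G w C \<in> pos_reals"
  shows "vec_space.rank n (signless_incidence G w) = n - 1
    \<and> (\<forall>i<m. \<forall>j<n.
         moore_penrose_inverse (signless_incidence G w) $$ (i, j) =
           1 / complex_of_real (\<Sum>T\<in>oriented_spanning_trees G. cmod (graph_weight T w))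
           * (\<Sum>T | T \<in> oriented_spanning_trees G \<and> i \<in> arcs T.
                complex_of_real (cmod (graph_weight T w))
                * moore_penrose_inverse (signless_incidence T w) $$ (arc_index T i, j)))
    \<and> (\<forall>T\<in>oriented_spanning_trees G. \<forall>i\<in>arcs T. \<forall>j<n.
         (j \<in> tail_component T i \<longrightarrow>
            moore_penrose_inverse (signless_incidence T w) $$ (arc_index T i, j) =
              (-1) ^ edge_dist T i j / of_nat n
              * (of_nat (card (head_component T i)) / csqrt (arc_weight G w i)
                 * (complex_of_real (cmod (walk_weight G w (tree_path T j (tail G i))))
                    / walk_weight G w (tree_path T j (tail G i)))))
       \<and> (j \<in> head_component T i \<longrightarrow>
            moore_penrose_inverse (signless_incidence T w) $$ (arc_index T i, j) =
              (-1) ^ edge_dist T i j / of_nat n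
              * (of_nat (card (tail_component T i)) / csqrt (cnj (arc_weight G w i))
                 * (complex_of_real (cmod (walk_weight G w (tree_path T j (head G i))))
                    / walk_weight G w (tree_path T j (head G i))))))"
proof -
  interpret oriented_graph G by fact
  note con = \<open>weakly_connected G\<close> and V = \<open>verts G = {..<n}\<close>
  have n0: "0 < n" using \<open>n \<ge> 2\<close> by simp
  obtain \<phi> where unit: "\<And>v. v \<in> verts G \<Longrightarrow> cmod (\<phi> v) = 1"
    and \<phi>: "\<And>u p v. uwalk G u p v \<Longrightarrow>
      \<phi> v = \<phi> u * ((- 1) ^ length p * (walk_weight G w p / cmod (walk_weight G w p)))"
    by (rule ex_gauge[OF con, of w]) (use assms(7,9,10) in \<open>blast+\<close>)
  \<comment> \<open>The potential equation for the walk that consists of the single step along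
    \<open>e\<close>.\<close>
  have gauge: "\<phi> (head G e) = \<phi> (tail G e) * (- arc_weight G w e / cmod (arc_weight G w e))"
    if e: "e \<in> arcs G" for e
  proof -
    have "uwalk G (tail G e) [(tail G e, head G e)] (head G e)"
      using e by (auto simp: uwalk_Cons uwalk_Nil parcs_mk_symmetric_iff)
    from \<phi>[OF this] show ?thesis by (simp add: walk_weight_def adj_weight_arc[OF e])
  qed
  interpret gauged_graph G n w \<phi>
    by unfold_locales (use V assms(7) unit gauge n0 in auto)
  \<comment> \<open>With these weights the product over the arcs of a tree \<open>T\<close> is
    \<open>|W\<^sub>T|\<close>.\<close>
  define c where "c e = complex_of_real (cmod (arc_weight G w e))" for e
  have "trees \<noteq> {}"
    using trees_nonempty con finite_arcs weakly_connected_iff by blast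
  have prod_c: "(\<Prod>a\<in>A. c a) = complex_of_real (\<Prod>a\<in>A. cmod (arc_weight G w a))" for A
    by (simp add: c_def)
  \<comment> \<open>Positivity keeps the denominator of \<open>mean_flow\<close> away from
    0.\<close>
  have "0 < (\<Sum>A\<in>trees. \<Prod>a\<in>A. cmod (arc_weight G w a))"
    using \<open>trees \<noteq> {}\<close> weight(1) by (intro sum_pos prod_pos) (auto simp: trees_def)
  then have W: "(\<Sum>A\<in>trees. \<Prod>a\<in>A. c a) \<noteq> 0"
    unfolding prod_c of_real_sum[symmetric] of_real_eq_0_iff by linarith
  have tree_flow_real: "cnj (tree_flow A e j) = tree_flow A e j" for A e j
    by (simp add: tree_flow_def)
  have cmean: "cnj (mean_flow c e j) = mean_flow c e j" for e j
    by (simp add: mean_flow_def tree_flow_real c_def)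
  note mean_facts = cmean
    incidence_mean_flow[OF W, unfolded V lessThan_iff card_lessThan]
    sum_mean_flow[OF W, unfolded V] mean_flow_exchange[OF W, unfolded c_def]
  have rank: "vec_space.rank n N = n - 1"
    by (rule rank_N[of "mean_flow c"]) (use mean_facts in \<open>auto simp: c_def[abs_def]\<close>)
  have "is_moore_penrose N (gauged_mat (mean_flow c))"
    by (rule is_moore_penrose_gauged_mat) (use mean_facts in \<open>auto simp: c_def[abs_def]\<close>)
  then have MPN: "moore_penrose_inverse N = gauged_mat (mean_flow c)"
    by (rule moore_penrose_inverse_eqI)
  have MP: "moore_penrose_inverse N $$ (i, j) = \<phi> j * mean_flow c i j / scale i"
    if "i < m" "j < n" for i j
  proof -
    \<comment> \<open>For the full arc set the row of an arc is its label.\<close>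
    have "{a \<in> arcs G. a < i} = {..<i}" using that(1) unfolding \<open>arcs G = {..<m}\<close> by auto
    then show ?thesis
      using that nth_sorted_list_of_set_card[of "arcs G" i] \<open>arcs G = {..<m}\<close>
      by (simp add: MPN gauged_mat_def)
  qed
  have MPT: "moore_penrose_inverse (signless_incidence T w) $$ (arc_index T i, j) =
      \<phi> j * tree_flow (arcs T) i j / scale i"
    if T: "T \<in> oriented_spanning_trees G" and i: "i \<in> arcs T" and j: "j < n" for T i j
  proof -
    have span: "spanning T G" and tree: "oriented_tree T"
      using T by (auto simp: oriented_spanning_trees_def)
    note sp = spanning_facts[OF span]
    have aw: "arc_weight T w = arc_weight G w" using sp by (simp add: fun_eq_iff arc_weight_def)
    interpret T: oriented_graph T by (rule sp(5))
    \<comment> \<open>The potential of the whole graph restricts to \<open>T\<close>, so all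
      inverses involve the same \<open>\<phi>\<close>.\<close>
    interpret T: gauged_graph T n w \<phi>
      by unfold_locales (use sp V assms(7) unit gauge n0 aw in auto)
    have cut: "T.cut_tree (arcs T)" using T.oriented_tree_iff tree by blast
    then have trees: "arcs T \<in> T.trees" by (simp add: T.trees_def)
    let ?F = "T.tree_flow (arcs T)"
    \<comment> \<open>For a single tree \<open>F B\<close> is the identity, which makes the symmetry
      condition immediate.\<close>
    have diff: "?F e (tail T f) - ?F e (head T f) = of_bool (e = f)"
      if "e \<in> arcs T" "f \<in> arcs T" for e f
      using T.tail_side_facts[OF cut subset_refl that(1)] that by (auto simp: T.tree_flow_def T.crosses_def)
    have "is_moore_penrose (signless_incidence T w) (T.gauged_mat ?F)"
    proof (rule T.is_moore_penrose_gauged_mat)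
      show "cnj (?F e j) = ?F e j" for e j by (simp add: T.tree_flow_def)
      show "(\<Sum>e\<in>arcs T. T.incidence i e * ?F e j) = of_bool (i = j) - 1 / of_nat n"
        if "i < n" "j < n" for i j
        using T.incidence_tree_flow[OF trees, of i j] that sp(1) V by simp
      show "(\<Sum>j<n. ?F e j) = 0" for e
        using T.sum_tree_flow[OF trees, of e] sp(1) V by simp
      show "cmod (arc_weight T w f) * (?F e (tail T f) - ?F e (head T f)) =
          cmod (arc_weight T w e) * (?F f (tail T e) - ?F f (head T e))"
        if "e \<in> arcs T" "f \<in> arcs T" for e f
        using that by (simp add: diff)
    qed
    then have "moore_penrose_inverse (signless_incidence T w) = T.gauged_mat ?F"
      by (rule moore_penrose_inverse_eqI)
    moreover have "T.scale i = scale i" using sp aw by (simp add: T.scale_def scale_def)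
    moreover have "?F = tree_flow (arcs T)" using cuts_cong(5)[OF sp(1-3)] by simp
    ultimately show ?thesis
      using nth_sorted_list_of_set_card[OF T.finite_arcs i] j
      by (simp add: T.gauged_mat_def arc_index_def)
  qed

  \<comment> \<open>The average over all spanning trees\<close>
  let ?ost = "oriented_spanning_trees G"
  have bij: "bij_betw arcs ?ost trees"
    by (rule bij_betw_arcs_oriented_spanning_trees) (use V n0 in auto)
  have gw: "complex_of_real (cmod (graph_weight T w)) = (\<Prod>a\<in>arcs T. c a)" if "T \<in> ?ost" for T
  proof -
    have "spanning T G" using that by (simp add: oriented_spanning_trees_def)
    from spanning_facts(2,3)[OF this] show ?thesis
      by (simp add: graph_weight_def c_def arc_weight_def prod_norm[symmetric])
  qed
  have fin: "finite ?ost" using bij_betw_finite[OF bij] by simp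
  have average: "moore_penrose_inverse N $$ (i, j) =
           1 / complex_of_real (\<Sum>T\<in>?ost. cmod (graph_weight T w))
           * (\<Sum>T | T \<in> ?ost \<and> i \<in> arcs T. complex_of_real (cmod (graph_weight T w))
                * moore_penrose_inverse (signless_incidence T w) $$ (arc_index T i, j))"
    if ij: "i < m" "j < n" for i j
  proof -
    have "complex_of_real (\<Sum>T\<in>?ost. cmod (graph_weight T w)) = (\<Sum>A\<in>trees. \<Prod>a\<in>A. c a)"
      unfolding of_real_sum by (simp add: gw sum.reindex_bij_betw[OF bij, symmetric])
    moreover have "(\<Sum>T | T \<in> ?ost \<and> i \<in> arcs T. complex_of_real (cmod (graph_weight T w))
                * moore_penrose_inverse (signless_incidence T w) $$ (arc_index T i, j)) =
        (\<Sum>T | T \<in> ?ost \<and> i \<in> arcs T. (\<Prod>a\<in>arcs T. c a) * (\<phi> j * tree_flow (arcs T) i j / scale i))"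
      by (intro sum.cong refl) (simp add: gw MPT ij)
    \<comment> \<open>Trees without \<open>i\<close> may be added, since their flow on
      \<open>i\<close> is 0 by default.\<close>
    moreover have "\<dots> = (\<Sum>T\<in>?ost. (\<Prod>a\<in>arcs T. c a) * (\<phi> j * tree_flow (arcs T) i j / scale i))"
      by (rule sum.mono_neutral_left) (auto simp: fin tree_flow_def)
    moreover have "\<dots> = (\<Sum>A\<in>trees. (\<Prod>a\<in>A. c a) * (\<phi> j * tree_flow A i j / scale i))"
      by (rule sum.reindex_bij_betw[OF bij])
    moreover have "\<dots> = \<phi> j / scale i * (\<Sum>A\<in>trees. (\<Prod>a\<in>A. c a) * tree_flow A i j)"
      by (simp add: sum_distrib_left ac_simps)
    ultimately show ?thesis by (simp add: MP[OF ij] mean_flow_def)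
  qed

  \<comment> \<open>The closed form of the entries for one tree\<close>
  have entry: "(j \<in> tail_component T i \<longrightarrow>
            \<phi> j * tree_flow (arcs T) i j / scale i =
              (-1) ^ edge_dist T i j / of_nat n
              * (of_nat (card (head_component T i)) / csqrt (arc_weight G w i)
                 * (complex_of_real (cmod (walk_weight G w (tree_path T j (tail G i))))
                    / walk_weight G w (tree_path T j (tail G i)))))
       \<and> (j \<in> head_component T i \<longrightarrow>
            \<phi> j * tree_flow (arcs T) i j / scale i =
              (-1) ^ edge_dist T i j / of_nat n
              * (of_nat (card (tail_component T i)) / csqrt (cnj (arc_weight G w i))
                 * (complex_of_real (cmod (walk_weight G w (tree_path T j (head G i))))
                    / walk_weight G w (tree_path T j (head G i)))))"
    if T: "T \<in> ?ost" and i: "i \<in> arcs T" and j: "j < n" for T i j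
  proof -
    have span: "spanning T G" and tree: "oriented_tree T"
      using T by (auto simp: oriented_spanning_trees_def)
    note sp = spanning_facts[OF span]
    interpret T: oriented_graph T by (rule sp(5))
    have cut: "T.cut_tree (arcs T)" using T.oriented_tree_iff tree by blast
    have iG: "i \<in> arcs G" using sp(4) i by blast
    have jV: "j \<in> verts T" using j sp(1) V by simp
    \<comment> \<open>The potential along the tree path supplies the phase, inverted since the path
      runs from \<open>j\<close> to \<open>x\<close>. Its sign depends on the length of the path,
      which has the parity of the distance.\<close>
    have path: "\<phi> j / \<phi> x = (- 1) ^ graph_dist T x j *
        (cmod (walk_weight G w (tree_path T j x)) / walk_weight G w (tree_path T j x))"
      if x: "x \<in> verts T" for x
    proof -
      let ?p = "tree_path T j x"
      have p: "uwalk T j ?p x" by (rule T.tree_path_uwalk[OF tree jV x])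
      obtain q where q: "uwalk T x q j" "length q = graph_dist T x j"
        using T.graph_dist_uwalk[OF _ x jV] tree by (auto simp: oriented_tree_def)
      have "(- 1 :: complex) ^ graph_dist T x j = (- 1) ^ length ?p"
        using T.tree_uwalk_parity[OF tree p q(1)] q(2) by simp
      moreover have "\<phi> x = \<phi> j * ((- 1) ^ length ?p * (walk_weight G w ?p / cmod (walk_weight G w ?p)))"
        by (rule \<phi>[OF uwalk_spanning[OF span p]])
      moreover have "\<phi> j \<noteq> 0" using gauge_nonzero j by blast
      ultimately show ?thesis by (simp add: minus_one_power_iff)
    qed
    let ?P = "T.tail_side (arcs T) i"
    have tc: "tail_component T i = ?P" and hc: "head_component T i = verts T - ?P"
      using T.tail_component_eq[OF cut i] T.head_component_eq[OF cut i] by auto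
    have P: "?P \<subseteq> verts T" using T.tail_side_facts(1)[OF cut subset_refl i] .
    have cards: "card (verts T) = n" "finite (verts T)" using sp(1) V by auto
    have card_hc: "of_nat (card (head_component T i)) = (of_nat n - of_nat (card ?P) :: complex)"
      unfolding hc using P cards card_mono[OF cards(2) P]
    by (simp add: card_Diff_subset finite_subset of_nat_diff)
    have flow: "tree_flow (arcs T) i j = of_bool (j \<in> ?P) - of_nat (card ?P) / of_nat n"
      using i cards V sp(1) cuts_cong(4)[OF sp(1-3)] by (simp add: tree_flow_def)
    have ends: "tail G i \<in> verts T" "head G i \<in> verts T" using sp(1) iG by auto
    show ?thesis
    proof (intro conjI impI)
      assume jt: "j \<in> tail_component T i"
      \<comment> \<open>On the tail side the flow is \<open>1 - |?P| / n\<close>, the share of the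
        head component.\<close>
      have "\<phi> j * tree_flow (arcs T) i j / scale i =
          \<phi> j / \<phi> (tail G i) * (of_nat (card (head_component T i)) / of_nat n / csqrt (arc_weight G w i))"
        using jt n0 by (simp add: flow tc card_hc scale_def field_simps)
      also have "\<phi> j / \<phi> (tail G i) = (- 1) ^ edge_dist T i j *
          (cmod (walk_weight G w (tree_path T j (tail G i))) / walk_weight G w (tree_path T j (tail G i)))"
        using path[OF ends(1)] T.edge_dist_tail[OF tree i jt] sp(2) by simp
      finally show "\<phi> j * tree_flow (arcs T) i j / scale i =
              (-1) ^ edge_dist T i j / of_nat n
              * (of_nat (card (head_component T i)) / csqrt (arc_weight G w i)
                 * (complex_of_real (cmod (walk_weight G w (tree_path T j (tail G i))))
                    / walk_weight G w (tree_path T j (tail G i))))"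
        by (simp add: ac_simps)
    next
      assume jh: "j \<in> head_component T i"
      \<comment> \<open>On the head side the flow is \<open>- |?P| / n\<close>, and its sign cancels
        against the one in \<open>scale_head\<close>.\<close>
      have "\<phi> j * tree_flow (arcs T) i j / scale i =
          \<phi> j / \<phi> (head G i) * (of_nat (card (tail_component T i)) / of_nat n / csqrt (cnj (arc_weight G w i)))"
        using jh n0 by (simp add: flow tc hc scale_head[OF iG] field_simps)
      also have "\<phi> j / \<phi> (head G i) = (- 1) ^ edge_dist T i j *
          (cmod (walk_weight G w (tree_path T j (head G i))) / walk_weight G w (tree_path T j (head G i)))"
        using path[OF ends(2)] T.edge_dist_head[OF tree i jh] sp(3) by simp
      finally show "\<phi> j * tree_flow (arcs T) i j / scale i =
              (-1) ^ edge_dist T i j / of_nat n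
              * (of_nat (card (tail_component T i)) / csqrt (cnj (arc_weight G w i))
                 * (complex_of_real (cmod (walk_weight G w (tree_path T j (head G i))))
                    / walk_weight G w (tree_path T j (head G i))))"
        by (simp add: ac_simps)
    qed
  qed
  show ?thesis
    using rank average entry by (simp add: MPT)
qed

end
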